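(* Let $T$ be a tree, and let $G\le\mathrm{Aut}(T)$ have property $(\mathrm{P})$. Suppose $\Delta=(\Gamma,(X_a),(G(v)))$ is the local action diagram of $(T,G)$, such that $\Gamma$ is finite and not a cycle graph. Then $G$ is geometrically dense if and only if for every leaf $v$ of $\Gamma$ we have $|X_v|>1$. In particular, if $\Delta$ has no stray leaves then $G^+$ is abstractly simple or trivial.
   Context: Graphs. A graph $\Gamma$ has a vertex set $V\Gamma$, an arc set $A\Gamma$, an origin map $o:A\Gamma\to V\Gamma$ and a reversal map $a\mapsto\overline a$ on $A\Gamma$ with $\overline{\overline a}=a$; $t(a):=o(\overline a)$. An arc with $o(a)=t(a)$ is a loop; for a loop both $\overline a=a$ and $\overline a\neq a$ are allowed. $\Gamma$ is finite if $V\Gamma$ and $A\Gamma$ are finite. $o^{-1}(v)$ is the set of arcs with origin $v$; the degree of $v$ is $|o^{-1}(v)|$. A leaf is a vertex $v$ with $|o^{-1}(v)|=1$ such that the arc in $o^{-1}(v)$ is not a loop. A cycle graph is a finite connected graph in which all vertices have degree $2$ and no arc equals its own reverse (the cycle graph of order $1$ is a vertex with a loop $a\neq\overline a$; that of order $2$ is two vertices joined by two edges). A tree is a nonempty connected graph without loops, multiple edges or cycles; subtrees are nonempty connected subgraphs; ends are equivalence classes of rays, two rays being equivalent if they share infinitely many vertices. $G\backslash T$ is the graph of $G$-orbits on vertices and arcs. Property $(\mathrm{P})$. For a nonempty (finite or infinite) simple path $L$ in $T$, let $\pi_L:VT\to VL$ be the closest point projection and $G_{(L)}$ the pointwise stabiliser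 of $L$; for $x\in VL$ let $\phi_x:G_{(L)}\to\mathrm{Sym}(\pi_L^{-1}(x))$ be given by the action. $G$ has property $(\mathrm{P})$ if for every such $L$ the homomorphism $G_{(L)}\to\prod_{x\in VL}\phi_x(G_{(L)})$ is surjective. $G$ is geometrically dense if it preserves no proper subtree of $T$ and fixes no end of $T$. $G^+$ is the subgroup of $G$ generated by the stabilisers in $G$ of arcs of $T$. Local action diagram of $(T,G)$: $\Gamma=G\backslash T$ with quotient map $\pi$; for each $v\in V\Gamma$ a vertex $v^*\in\pi^{-1}(v)$ is chosen; for $a\in o^{-1}(v)$, $X_a=\{b\in o^{-1}(v^* ):\pi(b)=a\}$; $X_v=\bigsqcup_{a\in o^{-1}(v)}X_a=o^{-1}(v^* )$; $G(v)$ is the closure in $\mathrm{Sym}(X_v)$ (topology of pointwise convergence) of the permutation group induced by $G_{v^*}$ on $X_v$. A stray leaf of $\Delta$ is a leaf $v$ of $\Gamma$ with $|X_v|=1$. *)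

theory Defs
  imports
    "HOL-Algebra.Bij"
    "HOL-Algebra.Group_Action"
    "HOL-Algebra.Generated_Groups"
    "HOL-Analysis.Function_Topology"
begin

subsection \<open>Graphs\<close>

text \<open>
  The bidirected digraphs of the AFP exclude arcs that equal their own reverse. Such arcs occur
  in quotients of trees by groups acting with inversions, so a separate record is used.
\<close>

record ('v, 'a) arc_graph =
  verts :: "'v set"
  arcs :: "'a set"
  origin :: "'a \<Rightarrow> 'v"
  reversal :: "'a \<Rightarrow> 'a"

definition wf_graph :: "('v, 'a) arc_graph \<Rightarrow> bool" where
  "wf_graph \<Gamma> \<longleftrightarrow>
     origin \<Gamma> \<in> arcs \<Gamma> \<rightarrow> verts \<Gamma> \<and>
     reversal \<Gamma> \<in> arcs \<Gamma> \<rightarrow> arcs \<Gamma> \<and>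
     (\<forall>a\<in>arcs \<Gamma>. reversal \<Gamma> (reversal \<Gamma> a) = a)"

definition terminus :: "('v, 'a) arc_graph \<Rightarrow> 'a \<Rightarrow> 'v" where
  "terminus \<Gamma> a = origin \<Gamma> (reversal \<Gamma> a)"

definition is_loop :: "('v, 'a) arc_graph \<Rightarrow> 'a \<Rightarrow> bool" where
  "is_loop \<Gamma> a \<longleftrightarrow> origin \<Gamma> a = terminus \<Gamma> a"

definition arcs_from :: "('v, 'a) arc_graph \<Rightarrow> 'v \<Rightarrow> 'a set" where
  "arcs_from \<Gamma> v = {a \<in> arcs \<Gamma>. origin \<Gamma> a = v}"

definition leaf :: "('v, 'a) arc_graph \<Rightarrow> 'v \<Rightarrow> bool" where
  "leaf \<Gamma> v \<longleftrightarrow>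
     v \<in> verts \<Gamma> \<and> card (arcs_from \<Gamma> v) = 1 \<and> (\<forall>a\<in>arcs_from \<Gamma> v. \<not> is_loop \<Gamma> a)"

definition adj :: "('v, 'a) arc_graph \<Rightarrow> 'v rel" where
  "adj \<Gamma> = {(origin \<Gamma> a, terminus \<Gamma> a) | a. a \<in> arcs \<Gamma>}"

definition connected_graph :: "('v, 'a) arc_graph \<Rightarrow> bool" where
  "connected_graph \<Gamma> \<longleftrightarrow>
     wf_graph \<Gamma> \<and> verts \<Gamma> \<noteq> {} \<and> (\<forall>u\<in>verts \<Gamma>. \<forall>v\<in>verts \<Gamma>. (u, v) \<in> (adj \<Gamma>)\<^sup>*)"

definition finite_graph :: "('v, 'a) arc_graph \<Rightarrow> bool" where
  "finite_graph \<Gamma> \<longleftrightarrow> finite (verts \<Gamma>) \<and> finite (arcs \<Gamma>)"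

definition cycle_graph :: "('v, 'a) arc_graph \<Rightarrow> bool" where
  "cycle_graph \<Gamma> \<longleftrightarrow>
     finite_graph \<Gamma> \<and> connected_graph \<Gamma> \<and>
     (\<forall>v\<in>verts \<Gamma>. card (arcs_from \<Gamma> v) = 2) \<and>
     (\<forall>a\<in>arcs \<Gamma>. reversal \<Gamma> a \<noteq> a)"


subsection \<open>Trees, paths and ends\<close>

text \<open>
  Cycles of length one and two are the loops and the multiple edges, which are treated
  separately in the definition of a tree, so only cycles of length at least three remain.
\<close>

definition is_cycle :: "('v, 'a) arc_graph \<Rightarrow> 'v list \<Rightarrow> bool" where
  "is_cycle \<Gamma> vs \<longleftrightarrow>
     3 \<le> length vs \<and> distinct vs \<and>
     (\<forall>i<length vs. (vs ! i, vs ! (Suc i mod length vs)) \<in> adj \<Gamma>)"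

definition tree :: "('v, 'a) arc_graph \<Rightarrow> bool" where
  "tree T \<longleftrightarrow>
     connected_graph T \<and>
     (\<forall>a\<in>arcs T. \<not> is_loop T a) \<and>
     (\<forall>a\<in>arcs T. \<forall>b\<in>arcs T. origin T a = origin T b \<and> terminus T a = terminus T b \<longrightarrow> a = b) \<and>
     (\<nexists>vs. is_cycle T vs)"

text \<open>A subgraph is given by its vertex set and its arc set.\<close>

definition subtree :: "('v, 'a) arc_graph \<Rightarrow> 'v set \<Rightarrow> 'a set \<Rightarrow> bool" where
  "subtree T W B \<longleftrightarrow>
     W \<subseteq> verts T \<and> B \<subseteq> arcs T \<and> connected_graph (T\<lparr>verts := W, arcs := B\<rparr>)"

definition rays :: "('v, 'a) arc_graph \<Rightarrow> (nat \<Rightarrow> 'v) set" where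
  "rays T = {r. range r \<subseteq> verts T \<and> inj r \<and> (\<forall>n. (r n, r (Suc n)) \<in> adj T)}"

definition end_equiv :: "('v, 'a) arc_graph \<Rightarrow> (nat \<Rightarrow> 'v) rel" where
  "end_equiv T = {(r, s). r \<in> rays T \<and> s \<in> rays T \<and> infinite (range r \<inter> range s)}"

definition ends :: "('v, 'a) arc_graph \<Rightarrow> (nat \<Rightarrow> 'v) set set" where
  "ends T = rays T // end_equiv T"

text \<open>
  A nonempty simple path, with finitely many vertices or infinite in one or in both directions,
  is an injective sequence of vertices indexed by a nonempty interval of integers. In a
  tree the arcs of such a path are determined by its vertices.
\<close>

definition simple_path :: "('v, 'a) arc_graph \<Rightarrow> int set \<Rightarrow> (int \<Rightarrow> 'v) \<Rightarrow> bool" where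
  "simple_path T I p \<longleftrightarrow>
     I \<noteq> {} \<and> (\<forall>i\<in>I. \<forall>j\<in>I. {i..j} \<subseteq> I) \<and>
     p ` I \<subseteq> verts T \<and> inj_on p I \<and>
     (\<forall>i. i \<in> I \<and> i + 1 \<in> I \<longrightarrow> (p i, p (i + 1)) \<in> adj T)"

definition graph_dist :: "('v, 'a) arc_graph \<Rightarrow> 'v \<Rightarrow> 'v \<Rightarrow> nat" where
  "graph_dist T u v = (LEAST n. (u, v) \<in> adj T ^^ n)"

definition closest_point :: "('v, 'a) arc_graph \<Rightarrow> 'v set \<Rightarrow> 'v \<Rightarrow> 'v" where
  "closest_point T W v = (ARG_MIN (graph_dist T v) w. w \<in> W)"


subsection \<open>Groups of automorphisms\<close>

text \<open>An automorphism consists of a permutation of the vertices and a permutation of the arcs.\<close>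

definition Aut :: "('v, 'a) arc_graph \<Rightarrow> (('v \<Rightarrow> 'v) \<times> ('a \<Rightarrow> 'a)) monoid" where
  "Aut T = (BijGroup (verts T) \<times>\<times> BijGroup (arcs T))
     \<lparr>carrier := {(f, h). f \<in> Bij (verts T) \<and> h \<in> Bij (arcs T) \<and>
        (\<forall>a\<in>arcs T. origin T (h a) = f (origin T a) \<and> reversal T (h a) = h (reversal T a))}\<rparr>"

text \<open>
  In the following \<open>G\<close> is the underlying set of a subgroup of \<open>Aut T\<close>; it acts on the vertices
  by \<^const>\<open>fst\<close> and on the arcs by \<^const>\<open>snd\<close>.
\<close>

abbreviation grp :: "('v, 'a) arc_graph \<Rightarrow> (('v \<Rightarrow> 'v) \<times> ('a \<Rightarrow> 'a)) set
    \<Rightarrow> (('v \<Rightarrow> 'v) \<times> ('a \<Rightarrow> 'a)) monoid" where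
  "grp T G \<equiv> (Aut T)\<lparr>carrier := G\<rparr>"

abbreviation vert_orbit :: "('v, 'a) arc_graph \<Rightarrow> (('v \<Rightarrow> 'v) \<times> ('a \<Rightarrow> 'a)) set \<Rightarrow> 'v \<Rightarrow> 'v set" where
  "vert_orbit T G \<equiv> Group_Action.orbit (grp T G) fst"

abbreviation arc_orbit :: "('v, 'a) arc_graph \<Rightarrow> (('v \<Rightarrow> 'v) \<times> ('a \<Rightarrow> 'a)) set \<Rightarrow> 'a \<Rightarrow> 'a set" where
  "arc_orbit T G \<equiv> Group_Action.orbit (grp T G) snd"

text \<open>
  The images of the orbit of an arc \<open>a\<close> under \<open>origin T\<close> and \<open>reversal T\<close> are the orbits of the
  origin and of the reverse of \<open>a\<close>.
\<close>

definition quotient_graph :: "('v, 'a) arc_graph \<Rightarrow> (('v \<Rightarrow> 'v) \<times> ('a \<Rightarrow> 'a)) set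
    \<Rightarrow> ('v set, 'a set) arc_graph" where
  "quotient_graph T G =
     \<lparr>verts = vert_orbit T G ` verts T, arcs = arc_orbit T G ` arcs T,
      origin = (\<lambda>A. origin T ` A), reversal = (\<lambda>A. reversal T ` A)\<rparr>"

definition pointwise_stab :: "(('v \<Rightarrow> 'v) \<times> ('a \<Rightarrow> 'a)) set \<Rightarrow> 'v set
    \<Rightarrow> (('v \<Rightarrow> 'v) \<times> ('a \<Rightarrow> 'a)) set" where
  "pointwise_stab G W = {g \<in> G. \<forall>x\<in>W. fst g x = x}"

definition fibre_action :: "('v, 'a) arc_graph \<Rightarrow> 'v set \<Rightarrow> 'v \<Rightarrow> ('v \<Rightarrow> 'v) \<times> ('a \<Rightarrow> 'a)
    \<Rightarrow> 'v \<Rightarrow> 'v" where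
  "fibre_action T W x g = restrict (fst g) {v \<in> verts T. closest_point T W v = x}"

definition property_P :: "('v, 'a) arc_graph \<Rightarrow> (('v \<Rightarrow> 'v) \<times> ('a \<Rightarrow> 'a)) set \<Rightarrow> bool" where
  "property_P T G \<longleftrightarrow>
     (\<forall>I p. simple_path T I p \<longrightarrow>
       (let L = p ` I; S = pointwise_stab G L
        in (\<lambda>g. \<lambda>x\<in>L. fibre_action T L x g) ` S = (\<Pi>\<^sub>E x\<in>L. fibre_action T L x ` S)))"

definition geometrically_dense ::
    "('v, 'a) arc_graph \<Rightarrow> (('v \<Rightarrow> 'v) \<times> ('a \<Rightarrow> 'a)) set \<Rightarrow> bool" where
  "geometrically_dense T G \<longleftrightarrow>
     (\<nexists>W B. subtree T W B \<and> (W, B) \<noteq> (verts T, arcs T) \<and>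
        (\<forall>g\<in>G. fst g ` W = W \<and> snd g ` B = B)) \<and>
     (\<nexists>\<epsilon>. \<epsilon> \<in> ends T \<and> (\<forall>g\<in>G. (\<lambda>r. fst g \<circ> r) ` \<epsilon> = \<epsilon>))"

definition G_plus :: "('v, 'a) arc_graph \<Rightarrow> (('v \<Rightarrow> 'v) \<times> ('a \<Rightarrow> 'a)) set
    \<Rightarrow> (('v \<Rightarrow> 'v) \<times> ('a \<Rightarrow> 'a)) set" where
  "G_plus T G = generate (Aut T) (\<Union>a\<in>arcs T. stabilizer (grp T G) snd a)"

text \<open>
  The locale \<open>simple_group\<close> of HOL-Algebra requires \<open>order G > 1\<close> and so excludes infinite
  groups, whose \<open>order\<close> is \<open>0\<close>.
\<close>

definition abstractly_simple :: "('g, 'b) monoid_scheme \<Rightarrow> bool" where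
  "abstractly_simple H \<longleftrightarrow>
     group H \<and> carrier H \<noteq> {\<one>\<^bsub>H\<^esub>} \<and> (\<forall>N. N \<lhd> H \<longrightarrow> N = carrier H \<or> N = {\<one>\<^bsub>H\<^esub>})"


subsection \<open>Local action diagrams\<close>

record ('v, 'a, 'x) action_diagram =
  base :: "('v, 'a) arc_graph"
  arc_colours :: "'a \<Rightarrow> 'x set"
  local_group :: "'v \<Rightarrow> ('x \<Rightarrow> 'x) set"

definition vert_colours :: "('v, 'a, 'x) action_diagram \<Rightarrow> 'v \<Rightarrow> 'x set" where
  "vert_colours \<Delta> v = (\<Union>a\<in>arcs_from (base \<Delta>) v. arc_colours \<Delta> a)"

definition stray_leaf :: "('v, 'a, 'x) action_diagram \<Rightarrow> 'v \<Rightarrow> bool" where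
  "stray_leaf \<Delta> v \<longleftrightarrow> leaf (base \<Delta>) v \<and> card (vert_colours \<Delta> v) = 1"

definition Sym_topology :: "'x set \<Rightarrow> ('x \<Rightarrow> 'x) topology" where
  "Sym_topology X = subtopology (product_topology (\<lambda>_. discrete_topology X) X) (Bij X)"

text \<open>The function \<open>s\<close> is the choice of the vertex called \<open>v\<^sup>*\<close> in each vertex orbit \<open>v\<close>.\<close>

definition is_local_action_diagram :: "('v, 'a) arc_graph \<Rightarrow> (('v \<Rightarrow> 'v) \<times> ('a \<Rightarrow> 'a)) set
    \<Rightarrow> ('v set, 'a set, 'a) action_diagram \<Rightarrow> bool" where
  "is_local_action_diagram T G \<Delta> \<longleftrightarrow>
     base \<Delta> = quotient_graph T G \<and>
     (\<exists>s. \<forall>v\<in>verts (base \<Delta>).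
        s v \<in> verts T \<and> vert_orbit T G (s v) = v \<and>
        (\<forall>a\<in>arcs_from (base \<Delta>) v.
           arc_colours \<Delta> a = {b \<in> arcs_from T (s v). arc_orbit T G b = a}) \<and>
        local_group \<Delta> v =
          Sym_topology (vert_colours \<Delta> v) closure_of
            ((\<lambda>g. restrict (snd g) (vert_colours \<Delta> v)) ` stabilizer (grp T G) fst (s v)))"

end

theory Submission
  imports Defs
begin

text \<open>
  A \<^emph>\<open>flow\<close> is an invariant set of arcs of \<open>T\<close> that contains no arc together with its reverse and
  that contains, with an arc \<open>(u, v)\<close>, every arc leaving \<open>v\<close> except \<open>(v, u)\<close>. The arcs pointing
  away from an invariant proper subtree or from a fixed end form a nonempty flow. Conversely, let \<open>F\<close> be a nonempty flow and \<open>U\<close>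
  the set of termini of its arcs. Each vertex of \<open>U\<close> is the terminus of exactly one arc in \<open>F\<close>,
  and if there is no stray leaf, it is also the origin of one. Counting orbits in a finite
  quotient shows that \<open>U\<close> contains all vertices and that the arcs of \<open>F\<close> leaving a vertex form one
  orbit, so the quotient is a cycle graph. A stray leaf, on the other hand, is an orbit of leaves
  of \<open>T\<close>, whose removal leaves an invariant subtree.

  The simplicity of \<open>G\<^sup>+\<close> is Tits' argument. If \<open>G\<close> has no flow, \<open>H \<noteq> 1\<close> is normalised by \<open>G\<close> and
  consists of elements of even displacement, and \<open>T\<close> is not a line, then every half-tree contains
  an axis of an element of \<open>H\<close>, because the arcs whose half-tree contains no such axis form a flow;
  hence \<open>H\<close> has no flow either. This applies to \<open>H = G\<^sup>+\<close>, and then to a nontrivial normal subgroup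
  \<open>N\<close> of \<open>G\<^sup>+\<close>. By property (P), an element fixing an arc is a product of two elements each fixing
  a half-tree, hence an axis of some \<open>h \<in> N\<close>, and such elements are commutators with \<open>h\<close>.
\<close>

subsection \<open>Distances in trees\<close>

locale tree_graph =
  fixes T :: "('v, 'a) arc_graph"
  assumes tree: "tree T"
begin

abbreviation "V \<equiv> verts T"
abbreviation "E \<equiv> adj T"
abbreviation "d \<equiv> graph_dist T"

lemma wf: "wf_graph T"
  using tree by (simp add: tree_def connected_graph_def)

lemma E_V: "(u, v) \<in> E \<Longrightarrow> u \<in> V \<and> v \<in> V"
  using wf by (auto simp: wf_graph_def adj_def terminus_def)

lemma E_sym: assumes "(u, v) \<in> E" shows "(v, u) \<in> E"
proof -
  obtain a where a: "a \<in> arcs T" "u = origin T a" "v = terminus T a"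
    using assms by (auto simp: adj_def)
  then have "reversal T a \<in> arcs T" "v = origin T (reversal T a)" "u = terminus T (reversal T a)"
    using wf by (auto simp: wf_graph_def terminus_def)
  then show ?thesis by (auto simp: adj_def)
qed

lemma E_irrefl: "(u, u) \<notin> E"
  using tree by (auto simp: tree_def adj_def is_loop_def)

lemma V_nonempty: "V \<noteq> {}"
  using tree by (simp add: tree_def connected_graph_def)

lemma E_connected: "u \<in> V \<Longrightarrow> v \<in> V \<Longrightarrow> (u, v) \<in> E\<^sup>*"
  using tree by (simp add: tree_def connected_graph_def)

section \<open>Walks without backtracking\<close>

fun reduced :: "'v list \<Rightarrow> bool" where
  "reduced [] \<longleftrightarrow> True"
| "reduced [x] \<longleftrightarrow> True"
| "reduced [x, y] \<longleftrightarrow> (x, y) \<in> E"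
| "reduced (x # y # z # zs) \<longleftrightarrow> (x, y) \<in> E \<and> x \<noteq> z \<and> reduced (y # z # zs)"

text \<open>The pieces overlap in an edge because the condition compares vertices two steps apart:
  each triple of consecutive vertices then lies within one piece.\<close>

lemma reduced_append:
  "reduced (xs @ a # b # ys) \<longleftrightarrow> reduced (xs @ [a, b]) \<and> reduced (a # b # ys)"
proof (induction xs)
  case Nil
  show ?case by (cases ys) auto
next
  case (Cons x xs)
  then show ?case by (cases xs; cases "tl xs"; auto)
qed

lemma reduced_rev: "reduced xs \<Longrightarrow> reduced (rev xs)"
proof (induction xs rule: reduced.induct)
  case (4 x y z zs)
  then have "reduced (rev zs @ [z, y])" by simp
  moreover have "(y, x) \<in> E" "(z, y) \<in> E" "z \<noteq> x" using 4(2) E_sym by (cases zs; auto)+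
  ultimately have "reduced (rev zs @ [z, y])" "reduced [z, y, x]" by auto
  then show ?case using reduced_append[of "rev zs" z y "[x]"] by simp
qed (auto simp: E_sym)

lemma reduced_nth: "reduced xs \<Longrightarrow> Suc i < length xs \<Longrightarrow> (xs ! i, xs ! Suc i) \<in> E"
proof (induction xs arbitrary: i rule: reduced.induct)
  case (4 x y z zs)
  then show ?case by (cases i) auto
qed auto

lemma reduced_ConsD: "reduced (x # xs) \<Longrightarrow> reduced xs"
  by (cases xs; cases "tl xs"; auto)

lemma reduced_butlastD: "reduced (xs @ [a]) \<Longrightarrow> reduced xs"
  using reduced_rev[of "xs @ [a]"] reduced_rev[of "rev xs"] reduced_ConsD by force

text \<open>A first return to \<open>x\<close> would close up: after one step it is a loop, after
  two a backtracking, and otherwise a cycle, whose vertices are distinct by the induction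
  hypothesis.\<close>

lemma reduced_distinct: "reduced xs \<Longrightarrow> distinct xs"
proof (induction xs)
  case (Cons x ys)
  then have red: "reduced ys" and dist: "distinct ys" using reduced_ConsD by auto
  show ?case
  proof (rule ccontr)
    assume "\<not> distinct (x # ys)"
    then have "x \<in> set ys" using dist by simp
    then obtain as bs where ys: "ys = as @ x # bs" and x: "x \<notin> set as"
      by (meson split_list_first)
    have nz: "as \<noteq> []" using Cons.prems ys E_irrefl by (cases bs) auto
    have "length as \<noteq> 1"
    proof
      assume "length as = 1"
      then obtain a where "as = [a]" by (cases as) auto
      then show False using Cons.prems ys by (cases bs) auto
    qed
    then have len: "3 \<le> length (x # as)" using nz by (cases as; cases "tl as"; auto)
    have dis: "distinct (x # as)" using dist ys x by auto
    have "((x # as) ! i, (x # as) ! (Suc i mod length (x # as))) \<in> E" if i: "i < length (x # as)" for i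
    proof -
      have l: "x # ys = (x # as) @ x # bs" using ys by simp
      have "((x # ys) ! i, (x # ys) ! Suc i) \<in> E"
        by (rule reduced_nth[OF Cons.prems]) (use i ys in simp)
      moreover have "(x # ys) ! i = (x # as) ! i" using i unfolding l by (simp only: nth_append if_True)
      moreover have "(x # ys) ! Suc i = (x # as) ! (Suc i mod length (x # as))"
      proof (cases "Suc i < length (x # as)")
        case True
        then show ?thesis unfolding l nth_append by simp
      next
        case False
        then have "Suc i = length (x # as)" using i by simp
        then show ?thesis unfolding l nth_append by simp
      qed
      ultimately show ?thesis by simp
    qed
    then have "is_cycle T (x # as)" using len dis by (simp add: is_cycle_def)
    then show False using tree by (simp add: tree_def)
  qed
qed simp

text \<open>Where two such walks part, the reverse of one followed by the other is again reduced,
  hence has distinct vertices, although it begins and ends at the common last vertex.\<close>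

lemma reduced_unique:
  "reduced (x # xs) \<Longrightarrow> reduced (x # ys) \<Longrightarrow> last (x # xs) = last (x # ys) \<Longrightarrow> xs = ys"
proof (induction xs arbitrary: x ys)
  case Nil
  then show ?case using reduced_distinct[OF Nil(2)] by (cases ys rule: rev_cases) auto
next
  case (Cons a xs)
  show ?case
  proof (cases ys)
    case Nil
    then show ?thesis using Cons.prems reduced_distinct[OF Cons.prems(1)]
      by (cases xs rule: rev_cases) auto
  next
    case (Cons b ys')
    note ys = this
    show ?thesis
    proof (cases "a = b")
      case True
      then show ?thesis using Cons.prems Cons.IH[of a ys'] ys reduced_ConsD by auto
    next
      case False
      have r1: "reduced (rev xs @ [a, x])" using reduced_rev[OF Cons.prems(1)] by simp
      have "reduced [a, x, b]" using Cons.prems ys False E_sym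
        by (cases xs; cases ys') auto
      then have "reduced ((rev xs @ [a]) @ [x, b])"
        using r1 reduced_append[of "rev xs" a x "[b]"] by simp
      then have "reduced ((rev xs @ [a]) @ x # b # ys')"
        using reduced_append[of "rev xs @ [a]" x b ys'] Cons.prems ys by simp
      then have "distinct (rev (a # xs) @ x # b # ys')" using reduced_distinct by fastforce
      moreover have "last (a # xs) = last (b # ys')" using Cons.prems ys by simp
      moreover have "last (a # xs) \<in> set (rev (a # xs))" by simp
      moreover have "last (b # ys') \<in> set (x # b # ys')" by simp
      ultimately show ?thesis by (metis disjoint_iff distinct_append)
    qed
  qed
qed

section \<open>Distances and geodesics\<close>

lemma dist_relpow: assumes "u \<in> V" "v \<in> V" shows "(u, v) \<in> E ^^ d u v"
proof -
  obtain n where "(u, v) \<in> E ^^ n" using E_connected[OF assms] rtrancl_imp_relpow by metis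
  then show ?thesis unfolding graph_dist_def by (rule LeastI)
qed

lemma dist_le: "(u, v) \<in> E ^^ n \<Longrightarrow> d u v \<le> n"
  unfolding graph_dist_def by (rule Least_le)

lemma relpow_sym: "(u, v) \<in> E ^^ n \<Longrightarrow> (v, u) \<in> E ^^ n"
proof (induction n arbitrary: u v)
  case (Suc n)
  then obtain x where "(u, x) \<in> E ^^ n" "(x, v) \<in> E" by auto
  then show ?case using Suc.IH E_sym by (meson relpow_Suc_I2)
qed simp

lemma dist_sym: "d u v = d v u"
  unfolding graph_dist_def using relpow_sym by (metis (no_types, lifting))

lemma dist_self [simp]: "d u u = 0"
  using dist_le[of u u 0] by simp

lemma dist_0: "u \<in> V \<Longrightarrow> v \<in> V \<Longrightarrow> d u v = 0 \<Longrightarrow> u = v"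
  using dist_relpow by fastforce

lemma dist_triangle: assumes "u \<in> V" "v \<in> V" "w \<in> V" shows "d u w \<le> d u v + d v w"
  using dist_relpow[OF assms(1,2)] dist_relpow[OF assms(2,3)]
  by (intro dist_le) (auto simp: relpow_add)

lemma dist_adj_le: assumes "w \<in> V" "(u, v) \<in> E" shows "d w v \<le> d w u + 1"
proof -
  have "d u v \<le> 1" using assms by (intro dist_le) auto
  then show ?thesis using dist_triangle[of w u v] E_V assms by force
qed

lemma dist_closer: assumes "w \<in> V" "v \<in> V" "v \<noteq> w"
  obtains u where "(u, v) \<in> E" "d w v = d w u + 1"
proof -
  have "d w v \<noteq> 0" using dist_0 assms by metis
  then obtain n where n: "d w v = Suc n" by (cases "d w v") auto
  then have "(w, v) \<in> E ^^ Suc n" using dist_relpow assms by metis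
  then obtain u where u: "(w, u) \<in> E ^^ n" "(u, v) \<in> E" by auto
  then have "d w u \<le> n" using dist_le by simp
  with dist_adj_le[OF assms(1) u(2)] n have "d w v = d w u + 1" by simp
  then show ?thesis using that u by blast
qed

lemma reduced_dist_le: "reduced (w # xs) \<Longrightarrow> w \<in> V \<Longrightarrow> d w (last (w # xs)) \<le> length xs"
proof (induction xs rule: rev_induct)
  case (snoc a xs)
  have r: "reduced (w # xs)"
    using snoc.prems reduced_butlastD[of "w # xs" a] by simp
  have "(last (w # xs), a) \<in> E"
    using reduced_nth[OF snoc.prems(1), of "length xs"]
    by (cases xs rule: rev_cases) (auto simp: nth_append nth_Cons split: nat.splits)
  then show ?case using snoc.IH[OF r snoc.prems(2)] dist_adj_le[OF snoc.prems(2)] by fastforce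
qed simp

text \<open>Appending \<open>v\<close> creates a backtracking only if the walk reached
  \<open>u\<close> from \<open>v\<close>; dropping \<open>u\<close> then leaves a walk to
  \<open>v\<close>.\<close>

lemma reduced_snoc:
  assumes red: "reduced (w # xs)" and last: "last (w # xs) = u" and uv: "(u, v) \<in> E"
  obtains "reduced (w # xs @ [v])"
  | ys where "reduced (w # ys)" "last (w # ys) = v" "length xs = length ys + 1"
proof (cases xs rule: rev_cases)
  case Nil
  then show ?thesis using last uv that(1) by auto
next
  case (snoc ys y)
  then have yu: "y = u" using last by simp
  obtain zs z where zs: "w # ys = zs @ [z]" by (metis append_butlast_last_id list.distinct(1))
  have r: "reduced (zs @ [z, u])" using red snoc yu zs by (metis append.assoc append_Cons append_Nil)
  show ?thesis
  proof (cases "z = v")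
    case True
    have "reduced (w # ys)" using red snoc reduced_butlastD[of "w # ys" y] by simp
    moreover have "last (w # ys) = v" using zs True by simp
    ultimately show ?thesis using that(2) snoc by simp
  next
    case False
    have "(z, u) \<in> E" using r by (metis reduced_append reduced.simps(3))
    then have "reduced [z, u, v]" using uv False by simp
    then have "reduced (zs @ z # u # [v])" using r reduced_append[of zs z u "[v]"] by blast
    then have "reduced (w # xs @ [v])" using zs snoc yu by (metis append.assoc append_Cons append_Nil)
    then show ?thesis by (rule that(1))
  qed
qed

lemma geodesic_reduced:
  assumes "w \<in> V" "v \<in> V"
  shows "\<exists>xs. reduced (w # xs) \<and> last (w # xs) = v \<and> length xs = d w v"
  using assms(2)
proof (induction "d w v" arbitrary: v)
  case 0
  then have "v = w" using dist_0 assms by metis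
  then show ?case using 0 by (intro exI[of _ "[]"]) auto
next
  case (Suc n)
  then have "v \<noteq> w" by auto
  then obtain u where u: "(u, v) \<in> E" "d w v = d w u + 1" using dist_closer Suc assms by metis
  then obtain xs where xs: "reduced (w # xs)" "last (w # xs) = u" "length xs = d w u"
    using Suc E_V by (metis Suc_eq_plus1 Suc_inject)
  show ?case
  proof (rule reduced_snoc[OF xs(1,2) u(1)])
    assume "reduced (w # xs @ [v])"
    then show ?case using xs u by (intro exI[of _ "xs @ [v]"]) auto
  next
    fix ys assume ys: "reduced (w # ys)" "last (w # ys) = v" "length xs = length ys + 1"
    then have "d w v \<le> length ys" using reduced_dist_le[OF ys(1) assms(1)] by simp
    then show ?case using ys(3) xs(3) u(2) by linarith
  qed
qed

text \<open>A geodesic is reduced, so by uniqueness a reduced walk is itself the geodesic between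
  its ends.\<close>

lemma reduced_dist: assumes "reduced (w # xs)" "w \<in> V" shows "d w (last (w # xs)) = length xs"
proof -
  have "last (w # xs) \<in> V"
    using assms reduced_nth[OF assms(1), of "length xs - 1"] E_V
    by (cases xs) (auto simp: last_conv_nth)
  then obtain ys where "reduced (w # ys)" "last (w # ys) = last (w # xs)"
     "length ys = d w (last (w # xs))"
    using geodesic_reduced assms by metis
  then show ?thesis using reduced_unique assms by metis
qed

text \<open>The reduced walk to \<open>u\<close> either extends or shortens to one ending at
  \<open>v\<close>. Equal distances are thereby excluded: a tree is bipartite.\<close>

lemma dist_adj: assumes w: "w \<in> V" and uv: "(u, v) \<in> E"
  shows "d w v = d w u + 1 \<or> d w u = d w v + 1"
proof -
  obtain xs where xs: "reduced (w # xs)" "last (w # xs) = u" "length xs = d w u"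
    using geodesic_reduced w uv E_V by metis
  show ?thesis
  proof (rule reduced_snoc[OF xs(1,2) uv])
    assume "reduced (w # xs @ [v])"
    then show ?thesis using reduced_dist[of w "xs @ [v]"] w xs by auto
  next
    fix ys assume ys: "reduced (w # ys)" "last (w # ys) = v" "length xs = length ys + 1"
    then show ?thesis using reduced_dist[OF ys(1) w] xs(3) by simp
  qed
qed

text \<open>Both vertices are the last but one on the unique reduced walk from \<open>w\<close> to
  \<open>v\<close>.\<close>

lemma closer_unique:
  assumes "w \<in> V" "(u, v) \<in> E" "(u', v) \<in> E" "d w v = d w u + 1" "d w v = d w u' + 1"
  shows "u = u'"
proof -
  have ex: "\<exists>xs. reduced (w # xs @ [v]) \<and> last (w # xs) = u"
    if uv: "(u, v) \<in> E" "d w v = d w u + 1" for u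
  proof -
    obtain xs where xs: "reduced (w # xs)" "last (w # xs) = u" "length xs = d w u"
      using geodesic_reduced assms(1) uv E_V by metis
    show ?thesis
    proof (rule reduced_snoc[OF xs(1,2) uv(1)])
      fix ys assume ys: "reduced (w # ys)" "last (w # ys) = v" "length xs = length ys + 1"
      then have "d w v = length ys" using reduced_dist[OF ys(1) assms(1)] by simp
      then show ?thesis using ys(3) xs(3) uv(2) by linarith
    qed (use xs in blast)
  qed
  obtain xs where xs: "reduced (w # xs @ [v])" "last (w # xs) = u" using ex assms by metis
  obtain ys where ys: "reduced (w # ys @ [v])" "last (w # ys) = u'" using ex assms by metis
  have "xs @ [v] = ys @ [v]" by (rule reduced_unique[OF xs(1) ys(1)]) simp
  then show ?thesis using xs ys by simp
qed

subsection \<open>Half-trees and lines\<close>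

text \<open>For an edge \<open>(u, v)\<close> this is the half-tree containing \<open>v\<close> that
  remains when the edge is removed; the other half-tree is \<open>side v u\<close>.\<close>

definition side :: "'v \<Rightarrow> 'v \<Rightarrow> 'v set" where
  "side u v = {w \<in> V. d w u = d w v + 1}"

lemma side_V: "side u v \<subseteq> V"
  by (auto simp: side_def)

lemma side_head: "(u, v) \<in> E \<Longrightarrow> v \<in> side u v"
  using dist_adj[of v v u] E_sym E_V by (auto simp: side_def)

lemma side_compl: "(u, v) \<in> E \<Longrightarrow> w \<in> V \<Longrightarrow> w \<in> side u v \<longleftrightarrow> w \<notin> side v u"
proof -
  assume "(u, v) \<in> E" "w \<in> V"
  then have "d w u = d w v + 1 \<longleftrightarrow> \<not> d w v = d w u + 1" using dist_adj[of w u v] by linarith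
  then show ?thesis using \<open>w \<in> V\<close> unfolding side_def by blast
qed

text \<open>Seen from a vertex beyond \<open>(v, w)\<close>, the only neighbour of \<open>v\<close>
  that is closer is \<open>w\<close>, so \<open>u\<close> is farther away than
  \<open>v\<close>.\<close>

lemma side_step: assumes "(u, v) \<in> E" "(v, w) \<in> E" "w \<noteq> u"
  shows "side v w \<subseteq> side u v"
proof
  fix z assume z: "z \<in> side v w"
  then have zV: "z \<in> V" and zd: "d z v = d z w + 1" by (auto simp: side_def)
  have "d z v \<noteq> d z u + 1"
    using closer_unique[OF zV assms(1) E_sym[OF assms(2)]] zd assms(3) by auto
  then show "z \<in> side u v" using dist_adj[OF zV assms(1)] zV unfolding side_def by blast
qed

text \<open>If \<open>y\<close> were not \<open>v\<close>, its neighbour towards \<open>v\<close>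
  would also be its neighbour towards \<open>u\<close>, hence equal to \<open>x\<close>; but
  \<open>x\<close> is not closer to \<open>v\<close> than \<open>y\<close> is.\<close>

lemma side_crossing:
  assumes uv: "(u, v) \<in> E" and xy: "(x, y) \<in> E" and x: "x \<in> side v u" and y: "y \<in> side u v"
  shows "x = u \<and> y = v"
proof -
  have V: "x \<in> V" "y \<in> V" "u \<in> V" "v \<in> V" using xy uv E_V by auto
  have e: "d v x = d u x + 1" "d u y = d v y + 1" using x y by (auto simp: side_def dist_sym)
  have f: "d u y = d u x + 1 \<or> d u x = d u y + 1" "d v y = d v x + 1 \<or> d v x = d v y + 1"
    using dist_adj xy V by auto
  then have g: "d u y = d u x + 1" "d v y = d u x" using e by linarith+
  have "y = v"
  proof (rule ccontr)
    assume "y \<noteq> v"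
    then obtain z where z: "(z, y) \<in> E" "d v y = d v z + 1" using dist_closer V by metis
    have zV: "z \<in> V" using z E_V by auto
    have "d u z \<le> d v z + 1" using dist_adj_le[OF zV E_sym[OF uv]] by (simp add: dist_sym)
    then have "d u y = d u z + 1" using e(2) z(2) dist_adj[OF V(3) z(1)] by linarith
    then have "z = x" using closer_unique[OF V(3) z(1) xy _ g(1)] by blast
    then have "d v y = d v x + 1" using z(2) by simp
    then show False using g(2) e(1) by linarith
  qed
  then have "d u x = 0" using g(2) by simp
  then show ?thesis using dist_0 V \<open>y = v\<close> by metis
qed

lemma rtrancl_crossing:
  assumes "(a, b) \<in> R\<^sup>*" "a \<in> P" "b \<notin> P"
  shows "\<exists>x y. (x, y) \<in> R \<and> x \<in> P \<and> y \<notin> P"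
  using assms by (induction rule: rtrancl_induct) blast+

text \<open>The form of \<open>side_crossing\<close> for a subgraph \<open>R\<close>: whatever
  connects the two half-trees uses the edge between them. It is applied to subtrees and to
  lines.\<close>

lemma connected_crossing:
  assumes "(a, b) \<in> R\<^sup>*" "R \<subseteq> E" "(u, v) \<in> E" "a \<in> side v u" "b \<in> side u v"
  shows "(u, v) \<in> R"
proof -
  have "b \<in> V" using assms(5) side_V by auto
  then have "b \<notin> side v u" using side_compl assms by blast
  then obtain x y where xy: "(x, y) \<in> R" "x \<in> side v u" "y \<notin> side v u"
    using rtrancl_crossing assms by metis
  then have "(x, y) \<in> E" using assms by auto
  moreover have "y \<in> side u v" using side_compl[OF assms(3)] xy E_V[OF \<open>(x, y) \<in> E\<close>] by blast
  ultimately show ?thesis using side_crossing assms(3) xy by blast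
qed

text \<open>The second conjunct strengthens the induction: it identifies the neighbour of
  \<open>q n\<close> that is closer to \<open>q 0\<close>, and the next vertex of the walk is a
  different one.\<close>

lemma walk_dist:
  fixes q :: "nat \<Rightarrow> 'v"
  assumes "\<And>i. i < n \<Longrightarrow> (q i, q (Suc i)) \<in> E" "\<And>i. Suc (Suc i) \<le> n \<Longrightarrow> q i \<noteq> q (Suc (Suc i))"
    and "q 0 \<in> V"
  shows "d (q 0) (q n) = n \<and> (\<forall>m. n = Suc m \<longrightarrow> d (q 0) (q m) = m)"
  using assms(1,2)
proof (induction n)
  case (Suc n)
  then have IH: "d (q 0) (q n) = n" "\<And>m. n = Suc m \<Longrightarrow> d (q 0) (q m) = m" by auto
  have e: "(q n, q (Suc n)) \<in> E" using Suc.prems by simp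
  have "d (q 0) (q n) \<noteq> d (q 0) (q (Suc n)) + 1"
  proof
    assume a: "d (q 0) (q n) = d (q 0) (q (Suc n)) + 1"
    then obtain m where m: "n = Suc m" using IH by (cases n) auto
    have "(q m, q n) \<in> E" using Suc.prems m by simp
    moreover have "d (q 0) (q n) = d (q 0) (q m) + 1" using IH m by simp
    ultimately have "q m = q (Suc n)"
      using closer_unique[OF assms(3) _ E_sym[OF e] _ a] by blast
    then show False using Suc.prems m by simp
  qed
  then have "d (q 0) (q (Suc n)) = Suc n" using dist_adj[OF assms(3) e] IH(1) by linarith
  then show ?case using IH(1) by simp
qed simp

section \<open>Two-sided infinite lines\<close>

definition line :: "(int \<Rightarrow> 'v) \<Rightarrow> bool" where
  "line p \<longleftrightarrow> (\<forall>i. (p i, p (i + 1)) \<in> E \<and> p i \<noteq> p (i + 2))"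

lemma line_E: "line p \<Longrightarrow> (p i, p (i + 1)) \<in> E"
  by (simp add: line_def)

lemma line_E': "line p \<Longrightarrow> (p i, p (i - 1)) \<in> E"
  using line_E[of p "i - 1"] E_sym by simp

lemma line_V: "line p \<Longrightarrow> p i \<in> V"
  using line_E E_V by blast

text \<open>Absence of backtracking alone makes a line geodesic, so injectivity need not be part of
  the definition.\<close>

lemma line_dist: assumes "line p" shows "d (p i) (p (i + int n)) = n"
proof -
  define q where "q k = p (i + int k)" for k
  have "i + int k + 1 = i + int (Suc k)" "i + int k + 2 = i + int (Suc (Suc k))" for k by simp_all
  then have "(q k, q (Suc k)) \<in> E" "q k \<noteq> q (Suc (Suc k))" "q 0 \<in> V" for k
    using assms line_V unfolding line_def q_def by metis+
  then have "d (q 0) (q n) = n" using walk_dist[of n q] by blast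
  then show ?thesis by (simp add: q_def)
qed

lemma line_inj: assumes "line p" shows "inj p"
proof (rule linorder_injI)
  fix i j :: int assume "i < j"
  then have "d (p i) (p j) = nat (j - i)" using line_dist[OF assms, of i "nat (j - i)"] by simp
  then show "p i \<noteq> p j" using \<open>i < j\<close> by auto
qed

lemma line_reverse: assumes "line p" shows "line (\<lambda>i. p (- i))"
  unfolding line_def
proof (intro allI conjI)
  fix i
  show "(p (- i), p (- (i + 1))) \<in> E" using line_E'[OF assms, of "- i"] by simp
  show "p (- i) \<noteq> p (- (i + 2))" using injD[OF line_inj[OF assms], of "- i" "- (i + 2)"] by auto
qed

lemma line_connected: assumes "line p"
  shows "(p i, p j) \<in> (E \<inter> range p \<times> range p)\<^sup>*"
proof -
  have up: "(p i, p (i + int n)) \<in> (E \<inter> range p \<times> range p)\<^sup>*" for i n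
  proof (induction n)
    case (Suc n)
    have "(p (i + int n), p (i + int (Suc n))) \<in> E \<inter> range p \<times> range p"
      using line_E[OF assms, of "i + int n"] by (auto simp: add.assoc add.commute[of 1])
    then show ?case using Suc by (meson rtrancl.rtrancl_into_rtrancl)
  qed simp
  have "sym (E \<inter> range p \<times> range p)" using E_sym by (auto simp: sym_def)
  then have "sym ((E \<inter> range p \<times> range p)\<^sup>*)" by (rule sym_rtrancl)
  moreover have "(p i, p j) \<in> (E \<inter> range p \<times> range p)\<^sup>* \<or> (p j, p i) \<in> (E \<inter> range p \<times> range p)\<^sup>*"
    using up[of i "nat (j - i)"] up[of j "nat (i - j)"] by (cases "i \<le> j") auto
  ultimately show ?thesis by (meson symD)
qed

text \<open>Such a line has vertices in both half-trees and is connected, so it runs through the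
  edge.\<close>

lemma line_crossing:
  assumes "line p" "(u, v) \<in> E" "\<not> range p \<subseteq> side u v" "\<not> range p \<subseteq> side v u"
  shows "u \<in> range p \<and> v \<in> range p"
proof -
  obtain i j where "p i \<notin> side u v" "p j \<notin> side v u" using assms by blast
  then have "p i \<in> side v u" "p j \<in> side u v" using side_compl assms line_V by blast+
  then have "(u, v) \<in> E \<inter> range p \<times> range p"
    using connected_crossing[OF line_connected[OF assms(1)] _ assms(2)] by blast
  then show ?thesis by blast
qed

section \<open>Points on geodesics, and parity of distances\<close>

definition between :: "'v \<Rightarrow> 'v \<Rightarrow> 'v \<Rightarrow> bool" where
  "between x m y \<longleftrightarrow> m \<in> V \<and> d x m + d m y = d x y"

text \<open>Induction on the distance from \<open>m\<close> to \<open>y\<close>: the neighbour of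
  \<open>y\<close> towards \<open>m\<close> is the one closer to \<open>x\<close>, hence the same
  for \<open>m'\<close>, and it can replace \<open>y\<close>.\<close>

lemma between_unique:
  assumes "x \<in> V" "y \<in> V" "between x m y" "between x m' y" "d x m = d x m'"
  shows "m = m'"
proof -
  have "\<forall>y\<in>V. \<forall>m m'. between x m y \<longrightarrow> between x m' y \<longrightarrow> d x m = d x m' \<longrightarrow> d m y = n \<longrightarrow> m = m'" for n
  proof (induction n)
    case 0
    show ?case
    proof (intro ballI allI impI)
      fix y m m' assume a: "y \<in> V" "between x m y" "between x m' y" "d x m = d x m'" "d m y = 0"
      then have "d m' y = 0" by (auto simp: between_def)
      then show "m = m'" using a dist_0 by (metis between_def)
    qed
  next
    case (Suc n)
    show ?case
    proof (intro ballI allI impI)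
      fix y m m' assume a: "y \<in> V" "between x m y" "between x m' y" "d x m = d x m'" "d m y = Suc n"
      have V: "m \<in> V" "m' \<in> V" using a by (auto simp: between_def)
      have my': "d m' y = Suc n" using a by (auto simp: between_def)
      have step: "\<exists>z. (z, y) \<in> E \<and> d x y = d x z + 1 \<and> between x m z \<and> d m z = n"
        if m: "between x m y" "d m y = Suc n" for m
      proof -
        have mV: "m \<in> V" using m by (auto simp: between_def)
        have "y \<noteq> m" using m by auto
        then obtain z where z: "(z, y) \<in> E" "d m y = d m z + 1" using dist_closer a mV by metis
        have "d x z \<le> d x m + d m z" using dist_triangle assms(1) mV z E_V by blast
        moreover have "d x y \<le> d x z + 1" using dist_adj_le[OF assms(1) z(1)] .
        ultimately have "d x y = d x z + 1" "d x m + d m z = d x z" using m z by (auto simp: between_def)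
        then show ?thesis using z mV m by (auto simp: between_def)
      qed
      obtain z where z: "(z, y) \<in> E" "d x y = d x z + 1" "between x m z" "d m z = n"
        using step a by blast
      obtain z' where z': "(z', y) \<in> E" "d x y = d x z' + 1" "between x m' z'"
        using step a my' by blast
      have "z = z'" using closer_unique[OF assms(1) z(1) z'(1) z(2) z'(2)] .
      then show "m = m'" using Suc.IH z z' a E_V by blast
    qed
  qed
  then show ?thesis using assms by blast
qed

text \<open>Moving \<open>z\<close> to its neighbour closer to \<open>y\<close> changes two of the
  three distances, each by one.\<close>

lemma dist_parity:
  assumes "x \<in> V" "y \<in> V" "z \<in> V"
  shows "even (d x y + d y z + d x z)"
proof -
  have "\<forall>z\<in>V. d y z = n \<longrightarrow> even (d x y + d y z + d x z)" for n
  proof (induction n)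
    case 0
    then show ?case using dist_0 assms by auto
  next
    case (Suc n)
    show ?case
    proof (intro ballI impI)
      fix z assume z: "z \<in> V" "d y z = Suc n"
      then have "z \<noteq> y" by auto
      then obtain w where w: "(w, z) \<in> E" "d y z = d y w + 1" using dist_closer z assms by metis
      then have "even (d x y + d y w + d x w)" using Suc z E_V by auto
      then show "even (d x y + d y z + d x z)" using dist_adj[OF assms(1) w(1)] w(2) by presburger
    qed
  qed
  then show ?thesis using assms by blast
qed

subsection \<open>Automorphisms\<close>

abbreviation "C \<equiv> carrier (Aut T)"

text \<open>The group laws of \<open>Aut T\<close> are inherited from the direct product of the two
  symmetric groups, so only closure has to be checked.\<close>

lemma subgroup_Aut: "subgroup C (BijGroup V \<times>\<times> BijGroup (arcs T))"
proof -
  have gB: "group (BijGroup S)" for S :: "'s set" by (rule group_BijGroup)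
  have cB: "carrier (BijGroup S) = Bij S" for S :: "'s set" by (simp add: BijGroup_def)
  have oV: "origin T a \<in> V" "reversal T a \<in> arcs T" if "a \<in> arcs T" for a
    using wf that by (auto simp: wf_graph_def)
  have hA: "h a \<in> S" if "h \<in> Bij S" "a \<in> S" for h :: "'s \<Rightarrow> 's" and S a
    using that by (auto simp: Bij_def bij_betw_def)
  show ?thesis
  proof (rule group.subgroupI[OF DirProd_group[OF gB gB]])
    show "C \<subseteq> carrier (BijGroup V \<times>\<times> BijGroup (arcs T))"
      by (auto simp: Aut_def cB)
    have "(\<one>\<^bsub>BijGroup V\<^esub>, \<one>\<^bsub>BijGroup (arcs T)\<^esub>) \<in> C"
      using oV group.is_monoid[OF gB[of V], THEN monoid.one_closed]
        group.is_monoid[OF gB[of "arcs T"], THEN monoid.one_closed]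
      by (auto simp: Aut_def cB) (auto simp: BijGroup_def)
    then show "C \<noteq> {}" by blast
    fix g assume "g \<in> C"
    then obtain f h where g: "g = (f, h)" "f \<in> Bij V" "h \<in> Bij (arcs T)"
      "\<And>a. a \<in> arcs T \<Longrightarrow> origin T (h a) = f (origin T a) \<and> reversal T (h a) = h (reversal T a)"
      by (auto simp: Aut_def)
    let ?f = "\<lambda>x\<in>V. inv_into V f x" and ?h = "\<lambda>x\<in>arcs T. inv_into (arcs T) h x"
    have i: "inv\<^bsub>BijGroup V \<times>\<times> BijGroup (arcs T)\<^esub> g = (?f, ?h)"
      using inv_DirProd[OF gB gB, of f V h "arcs T"] g(1-3) inv_BijGroup[OF g(2)] inv_BijGroup[OF g(3)]
      by (simp add: cB)
    have b: "bij_betw f V V" "bij_betw h (arcs T) (arcs T)" using g by (auto simp: Bij_def)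
    have "origin T (?h a) = ?f (origin T a) \<and> reversal T (?h a) = ?h (reversal T a)"
      if a: "a \<in> arcs T" for a
    proof -
      obtain c where c: "c \<in> arcs T" "a = h c" using b(2) a unfolding bij_betw_def by blast
      have "origin T a = f (origin T c)" "reversal T a = h (reversal T c)" using g c by auto
      then show ?thesis using a c b oV[OF a] oV[OF c(1)]
        by (simp add: bij_betw_inv_into_left)
    qed
    then show "inv\<^bsub>BijGroup V \<times>\<times> BijGroup (arcs T)\<^esub> g \<in> C"
      unfolding i using restrict_inv_into_Bij[OF g(2)] restrict_inv_into_Bij[OF g(3)] by (auto simp: Aut_def)
    fix g' assume "g' \<in> C"
    then obtain f' h' where g': "g' = (f', h')" "f' \<in> Bij V" "h' \<in> Bij (arcs T)"
      "\<And>a. a \<in> arcs T \<Longrightarrow> origin T (h' a) = f' (origin T a) \<and> reversal T (h' a) = h' (reversal T a)"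
      by (auto simp: Aut_def)
    have "g \<otimes>\<^bsub>BijGroup V \<times>\<times> BijGroup (arcs T)\<^esub> g' = (compose V f f', compose (arcs T) h h')"
      using g g' by (simp add: BijGroup_def)
    then show "g \<otimes>\<^bsub>BijGroup V \<times>\<times> BijGroup (arcs T)\<^esub> g' \<in> C"
      using g g' compose_Bij[OF g(2) g'(2)] compose_Bij[OF g(3) g'(3)] oV hA[OF g'(3)] by (auto simp: Aut_def compose_def)
  qed
qed

sublocale A: group "Aut T"
proof -
  have "group ((BijGroup V \<times>\<times> BijGroup (arcs T))\<lparr>carrier := C\<rparr>)"
    by (rule subgroup.subgroup_is_group[OF subgroup_Aut DirProd_group[OF group_BijGroup group_BijGroup]])
  moreover have "(BijGroup V \<times>\<times> BijGroup (arcs T))\<lparr>carrier := C\<rparr> = Aut T"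
    by (simp add: Aut_def)
  ultimately show "group (Aut T)" by simp
qed

abbreviation mul (infixl "\<bullet>" 70) where "g \<bullet> h \<equiv> g \<otimes>\<^bsub>Aut T\<^esub> h"
abbreviation "e1 \<equiv> \<one>\<^bsub>Aut T\<^esub>"
abbreviation "iv g \<equiv> inv\<^bsub>Aut T\<^esub> g"

lemma C_D:
  assumes "g \<in> C"
  shows "fst g \<in> Bij V" "snd g \<in> Bij (arcs T)"
    and "\<And>a. a \<in> arcs T \<Longrightarrow> origin T (snd g a) = fst g (origin T a)"
    and "\<And>a. a \<in> arcs T \<Longrightarrow> reversal T (snd g a) = snd g (reversal T a)"
  using assms by (auto simp: Aut_def)

lemma origin_V: "a \<in> arcs T \<Longrightarrow> origin T a \<in> V"
  and reversal_arcs: "a \<in> arcs T \<Longrightarrow> reversal T a \<in> arcs T"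
  and reversal_reversal: "a \<in> arcs T \<Longrightarrow> reversal T (reversal T a) = a"
  using wf by (auto simp: wf_graph_def)

lemma act_arcs: "g \<in> C \<Longrightarrow> a \<in> arcs T \<Longrightarrow> snd g a \<in> arcs T"
  using C_D(2)[of g] by (auto simp: Bij_def bij_betw_def)

lemma act_terminus: "g \<in> C \<Longrightarrow> a \<in> arcs T \<Longrightarrow> terminus T (snd g a) = fst g (terminus T a)"
  using C_D(3,4) reversal_arcs by (simp add: terminus_def)

lemma arc_eqI: "a \<in> arcs T \<Longrightarrow> b \<in> arcs T \<Longrightarrow> origin T a = origin T b \<Longrightarrow>
    terminus T a = terminus T b \<Longrightarrow> a = b"
  using tree unfolding tree_def by blast

lemma arc_E: "a \<in> arcs T \<Longrightarrow> (origin T a, terminus T a) \<in> E"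
  by (auto simp: adj_def)

lemma act_V [simp]: "g \<in> C \<Longrightarrow> v \<in> V \<Longrightarrow> fst g v \<in> V"
  using C_D(1)[of g] by (auto simp: Bij_def bij_betw_def)

lemma act_mult [simp]: "g \<in> C \<Longrightarrow> h \<in> C \<Longrightarrow> v \<in> V \<Longrightarrow> fst (g \<bullet> h) v = fst g (fst h v)"
  using C_D(1,2)[of g] C_D(1,2)[of h]
  by (cases g; cases h) (auto simp: Aut_def BijGroup_def compose_def)

lemma act_mult_arcs: "g \<in> C \<Longrightarrow> h \<in> C \<Longrightarrow> a \<in> arcs T \<Longrightarrow> snd (g \<bullet> h) a = snd g (snd h a)"
  using C_D(1,2)[of g] C_D(1,2)[of h]
  by (cases g; cases h) (auto simp: Aut_def BijGroup_def compose_def)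

lemma act_one [simp]: "v \<in> V \<Longrightarrow> fst e1 v = v"
  by (simp add: Aut_def BijGroup_def)

lemma act_one_arcs [simp]: "a \<in> arcs T \<Longrightarrow> snd e1 a = a"
  by (simp add: Aut_def BijGroup_def)

lemma act_inv [simp]: "g \<in> C \<Longrightarrow> v \<in> V \<Longrightarrow> fst (iv g) (fst g v) = v"
    "g \<in> C \<Longrightarrow> v \<in> V \<Longrightarrow> fst g (fst (iv g) v) = v"
  using act_mult[of "iv g" g v] act_mult[of g "iv g" v] by auto

lemma act_inj: "g \<in> C \<Longrightarrow> u \<in> V \<Longrightarrow> v \<in> V \<Longrightarrow> fst g u = fst g v \<longleftrightarrow> u = v"
  using act_inv by metis

lemma act_E: assumes "g \<in> C" "(u, v) \<in> E" shows "(fst g u, fst g v) \<in> E"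
proof -
  obtain a where a: "a \<in> arcs T" "u = origin T a" "v = terminus T a"
    using assms by (auto simp: adj_def)
  show ?thesis unfolding a(2,3)
    using arc_E[OF act_arcs[OF assms(1) a(1)]] C_D(3)[OF assms(1) a(1)] act_terminus[OF assms(1) a(1)]
    by metis
qed

text \<open>A tree has no multiple arcs, so the action on arcs is determined by that on vertices.
  Equations between automorphisms can therefore be tested on vertices.\<close>

lemma act_eqI: assumes g: "g \<in> C" and h: "h \<in> C" and eq: "\<And>v. v \<in> V \<Longrightarrow> fst g v = fst h v"
  shows "g = h"
proof (rule prod_eqI)
  show "fst g = fst h"
    using C_D(1)[OF g] C_D(1)[OF h] eq unfolding Bij_def by (auto intro: extensionalityI)
  have "snd g a = snd h a" if a: "a \<in> arcs T" for a
    using act_arcs[OF g a] act_arcs[OF h a] C_D(3)[OF g a] C_D(3)[OF h a]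
      act_terminus[OF g a] act_terminus[OF h a] eq E_V[OF arc_E[OF a]]
    by (intro arc_eqI) auto
  then show "snd g = snd h"
    using C_D(2)[OF g] C_D(2)[OF h] unfolding Bij_def by (auto intro: extensionalityI)
qed

lemma act_arc_fix: assumes g: "g \<in> C" and a: "a \<in> arcs T"
  shows "snd g a = a \<longleftrightarrow> fst g (origin T a) = origin T a \<and> fst g (terminus T a) = terminus T a"
  using arc_eqI[OF act_arcs[OF g a] a] C_D(3)[OF g a] act_terminus[OF g a] by metis

lemma act_dist_le: assumes "g \<in> C" "u \<in> V" "v \<in> V" shows "d (fst g u) (fst g v) \<le> d u v"
proof -
  have "(fst g u, fst g v) \<in> E ^^ n" if "(u, v) \<in> E ^^ n" for n
    using that by (induction n arbitrary: v) (auto intro: act_E[OF assms(1)])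
  then show ?thesis using dist_relpow[OF assms(2,3)] dist_le by blast
qed

lemma act_dist: assumes "g \<in> C" "u \<in> V" "v \<in> V" shows "d (fst g u) (fst g v) = d u v"
  using act_dist_le[OF assms] act_dist_le[of "iv g" "fst g u" "fst g v"] assms by simp

lemma act_side: assumes "g \<in> C" "u \<in> V" "v \<in> V" "w \<in> V"
  shows "fst g w \<in> side (fst g u) (fst g v) \<longleftrightarrow> w \<in> side u v"
  using assms act_dist by (simp add: side_def)

lemma act_side_inv: assumes "g \<in> C" "u \<in> V" "v \<in> V" "w \<in> V"
  shows "w \<in> side (fst g u) (fst g v) \<longleftrightarrow> fst (iv g) w \<in> side u v"
  using act_side[of g u v "fst (iv g) w"] assms by simp

subsection \<open>Flows\<close>

text \<open>Arcs are encoded as pairs of adjacent vertices, which is faithful in a tree; only the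
  action on vertices then enters.\<close>

definition flow :: "(('v \<Rightarrow> 'v) \<times> ('a \<Rightarrow> 'a)) set \<Rightarrow> 'v rel \<Rightarrow> bool" where
  "flow G F \<longleftrightarrow> F \<subseteq> E \<and>
     (\<forall>u v w. (u, v) \<in> F \<and> (v, w) \<in> E \<and> w \<noteq> u \<longrightarrow> (v, w) \<in> F) \<and>
     (\<forall>u v. (u, v) \<in> F \<longrightarrow> (v, u) \<notin> F) \<and>
     (\<forall>g u v. g \<in> G \<and> (u, v) \<in> F \<longrightarrow> (fst g u, fst g v) \<in> F)"

definition no_flow :: "(('v \<Rightarrow> 'v) \<times> ('a \<Rightarrow> 'a)) set \<Rightarrow> bool" where
  "no_flow G \<longleftrightarrow> (\<forall>F. flow G F \<longrightarrow> F = {})"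

lemma no_flowD:
  assumes "no_flow G" "F \<subseteq> E"
    and "\<And>u v w. (u, v) \<in> F \<Longrightarrow> (v, w) \<in> E \<Longrightarrow> w \<noteq> u \<Longrightarrow> (v, w) \<in> F"
    and "\<And>u v. (u, v) \<in> F \<Longrightarrow> (v, u) \<in> F \<Longrightarrow> False"
    and "\<And>g u v. g \<in> G \<Longrightarrow> (u, v) \<in> F \<Longrightarrow> (fst g u, fst g v) \<in> F"
  shows "F = {}"
proof -
  have "flow G F" unfolding flow_def using assms(2-) by blast
  then show ?thesis using assms(1) by (simp add: no_flow_def)
qed

section \<open>Without a flow there is no invariant proper subtree and no fixed end\<close>

lemma subtree_adj:
  assumes "subtree T W B"
  shows "adj (T\<lparr>verts := W, arcs := B\<rparr>) \<subseteq> E \<inter> W \<times> W"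
proof -
  have "wf_graph (T\<lparr>verts := W, arcs := B\<rparr>)" "B \<subseteq> arcs T"
    using assms by (auto simp: subtree_def connected_graph_def)
  then show ?thesis by (fastforce simp: adj_def terminus_def wf_graph_def)
qed

text \<open>The arcs whose half-tree misses \<open>W\<close> form a flow, so every half-tree meets
  \<open>W\<close>, and by connectedness every edge belongs to the subtree.\<close>

lemma no_flow_subtree:
  assumes G: "subgroup G (Aut T)" and nf: "no_flow G" and W: "subtree T W B"
    and inv: "\<And>g. g \<in> G \<Longrightarrow> fst g ` W = W"
  shows "W = V \<and> B = arcs T"
proof -
  let ?S = "T\<lparr>verts := W, arcs := B\<rparr>"
  have cg: "connected_graph ?S" and WV: "W \<subseteq> V" "B \<subseteq> arcs T" using W by (auto simp: subtree_def)
  then have W0: "W \<noteq> {}" and con: "\<And>x y. x \<in> W \<Longrightarrow> y \<in> W \<Longrightarrow> (x, y) \<in> (adj ?S)\<^sup>*"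
    by (auto simp: connected_graph_def)
  have GC: "G \<subseteq> C" using G by (rule subgroup.subset)
  have "{(u, v) \<in> E. W \<inter> side u v = {}} = {}"
  proof (rule no_flowD[OF nf])
    fix u v w assume "(u, v) \<in> {(u, v) \<in> E. W \<inter> side u v = {}}" "(v, w) \<in> E" "w \<noteq> u"
    then show "(v, w) \<in> {(u, v) \<in> E. W \<inter> side u v = {}}" using side_step by blast
  next
    fix u v assume "(u, v) \<in> {(u, v) \<in> E. W \<inter> side u v = {}}" "(v, u) \<in> {(u, v) \<in> E. W \<inter> side u v = {}}"
    then show False using W0 WV side_compl by blast
  next
    fix g u v assume g: "g \<in> G" and uv: "(u, v) \<in> {(u, v) \<in> E. W \<inter> side u v = {}}"
    have "W \<inter> side (fst g u) (fst g v) = {}"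
    proof (rule ccontr)
      assume "W \<inter> side (fst g u) (fst g v) \<noteq> {}"
      then obtain w where w: "w \<in> W" "w \<in> side (fst g u) (fst g v)" by blast
      then obtain x where x: "x \<in> W" "w = fst g x" using inv[OF g] by blast
      have "u \<in> V" "v \<in> V" "x \<in> V" using uv E_V x WV by auto
      then have "x \<in> side u v" using act_side w x g GC by blast
      then show False using uv x by blast
    qed
    then show "(fst g u, fst g v) \<in> {(u, v) \<in> E. W \<inter> side u v = {}}" using uv g GC act_E by blast
  qed auto
  then have none: "\<And>u v. (u, v) \<in> E \<Longrightarrow> W \<inter> side u v \<noteq> {}" by blast
  \<comment> \<open>An edge leaving \<open>W\<close> would have a vertex of \<open>W\<close> beyond
    it, and the connected subtree would have to contain that edge.\<close>
  have "W = V"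
  proof (rule ccontr)
    assume "W \<noteq> V"
    then obtain a b where ab: "a \<in> W" "b \<in> V" "b \<notin> W" using W0 WV by blast
    then have "(a, b) \<in> E\<^sup>*" using E_connected WV by blast
    from rtrancl_crossing[OF this ab(1,3)]
    obtain u v where uv: "(u, v) \<in> E" "u \<in> W" "v \<notin> W" by blast
    then obtain w where w: "w \<in> W" "w \<in> side u v" using none by blast
    have "u \<in> side v u" using side_head E_sym uv by blast
    then have "(u, v) \<in> adj ?S"
      using connected_crossing[OF con[OF uv(2) w(1)] _ uv(1)] w subtree_adj[OF W] by blast
    then show False using subtree_adj[OF W] uv by blast
  qed
  moreover have "arcs T \<subseteq> B"
  proof
    fix a assume a: "a \<in> arcs T"
    then have E: "(origin T a, terminus T a) \<in> E" by (rule arc_E)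
    then have "(origin T a, terminus T a) \<in> (adj ?S)\<^sup>*" using con E_V \<open>W = V\<close> by blast
    then have "(origin T a, terminus T a) \<in> adj ?S"
      using connected_crossing[OF _ _ E] subtree_adj[OF W] side_head[OF E] side_head[OF E_sym[OF E]] by blast
    then obtain b where "b \<in> B" "origin T b = origin T a" "terminus T b = terminus T a"
      by (auto simp: adj_def terminus_def)
    then show "a \<in> B" using arc_eqI a WV by blast
  qed
  ultimately show ?thesis using WV by blast
qed

lemma ray_E: "r \<in> rays T \<Longrightarrow> (r n, r (Suc n)) \<in> E"
  by (simp add: rays_def)

lemma ray_V: "r \<in> rays T \<Longrightarrow> r n \<in> V"
  by (auto simp: rays_def)

text \<open>After its finitely many visits to \<open>u\<close> and \<open>v\<close> the ray cannot
  change sides any more.\<close>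

lemma ray_side:
  assumes "r \<in> rays T" "(u, v) \<in> E"
  shows "finite (range r \<inter> side u v) \<or> finite (range r - side u v)"
proof -
  have inj: "inj r" using assms by (simp add: rays_def)
  have "finite {n. r n = u \<or> r n = v}"
    using finite_vimageI[OF _ inj, of "{u, v}"] by (simp add: vimage_def)
  then obtain M where M: "\<forall>n\<in>{n. r n = u \<or> r n = v}. n \<le> M"
    unfolding finite_nat_set_iff_bounded_le by blast
  define N where "N = Suc M"
  have N: "\<And>n. n \<ge> N \<Longrightarrow> r n \<noteq> u \<and> r n \<noteq> v" using M unfolding N_def by fastforce
  have const: "r n \<in> side u v \<longleftrightarrow> r N \<in> side u v" if "n \<ge> N" for n
    using that
  proof (induction n rule: dec_induct)
    case (step n)
    have "r n \<in> side u v \<longleftrightarrow> r (Suc n) \<in> side u v"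
      using side_crossing[OF assms(2) ray_E[OF assms(1), of n]]
        side_crossing[OF E_sym[OF assms(2)] ray_E[OF assms(1), of n]]
        side_compl[OF assms(2)] ray_V[OF assms(1)] N[of n] step by blast
    then show ?case using step by simp
  qed simp
  show ?thesis
  proof (cases "r N \<in> side u v")
    case True
    then have "n < N" if "r n \<in> range r - side u v" for n using const[of n] that by (cases "N \<le> n") auto
    then have "range r - side u v \<subseteq> r ` {..<N}" by blast
    then show ?thesis using finite_subset by blast
  next
    case False
    then have "n < N" if "r n \<in> range r \<inter> side u v" for n using const[of n] that by (cases "N \<le> n") auto
    then have "range r \<inter> side u v \<subseteq> r ` {..<N}" by blast
    then show ?thesis using finite_subset by blast
  qed
qed

text \<open>The arcs with only finitely many vertices of \<open>r\<close> beyond them are those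
  pointing away from the end of \<open>r\<close>; they form a nonempty flow.\<close>

lemma no_flow_end:
  assumes G: "subgroup G (Aut T)" and nf: "no_flow G" and eps: "\<epsilon> \<in> ends T"
    and inv: "\<And>g. g \<in> G \<Longrightarrow> (\<lambda>r. fst g \<circ> r) ` \<epsilon> = \<epsilon>"
  shows False
proof -
  have GC: "G \<subseteq> C" using G by (rule subgroup.subset)
  obtain r where r: "r \<in> rays T" and er: "\<epsilon> = end_equiv T `` {r}"
    using eps by (auto simp: ends_def quotient_def)
  let ?F = "{(u, v) \<in> E. finite (range r \<inter> side u v)}"
  have inf: "infinite (range s)" if "s \<in> rays T" for s
    using that range_inj_infinite by (auto simp: rays_def)
  have rr: "r \<in> \<epsilon>" using er r inf by (simp add: end_equiv_def)
  \<comment> \<open>Transfers finiteness from an equivalent ray \<open>s\<close> to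
    \<open>r\<close>; with \<open>s\<close> the image of \<open>r\<close> under \<open>g\<close>
    this gives invariance of the flow.\<close>
  have fin_equiv: "finite (range r \<inter> side u v)"
    if s: "s \<in> rays T" "infinite (range r \<inter> range s)" "(u, v) \<in> E" "finite (range s \<inter> side u v)" for s u v
  proof (rule ccontr)
    assume "infinite (range r \<inter> side u v)"
    then have "finite (range r - side u v)" using ray_side[OF r s(3)] by blast
    moreover have "range r \<inter> range s \<subseteq> (range r - side u v) \<union> (range s \<inter> side u v)" by blast
    ultimately show False using s finite_subset by blast
  qed
  have "?F = {}"
  proof (rule no_flowD[OF nf])
    fix u v w assume "(u, v) \<in> ?F" "(v, w) \<in> E" "w \<noteq> u"
    then show "(v, w) \<in> ?F" using side_step
      by (metis (mono_tags, lifting) Int_mono case_prodD case_prodI finite_subset mem_Collect_eq subset_refl)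
  next
    fix u v assume a: "(u, v) \<in> ?F" "(v, u) \<in> ?F"
    then have "range r \<subseteq> (range r \<inter> side u v) \<union> (range r \<inter> side v u)"
      using side_compl ray_V[OF r] by blast
    then show False using a inf[OF r] finite_subset by blast
  next
    fix g u v assume g: "g \<in> G" and uv: "(u, v) \<in> ?F"
    then have gC: "g \<in> C" using GC by blast
    have V: "u \<in> V" "v \<in> V" using uv E_V by auto
    have "fst g \<circ> r \<in> \<epsilon>" using inv[OF g] rr by blast
    then have s: "fst g \<circ> r \<in> rays T" "infinite (range r \<inter> range (fst g \<circ> r))"
      using er by (auto simp: end_equiv_def)
    have "range (fst g \<circ> r) \<inter> side (fst g u) (fst g v) \<subseteq> fst g ` (range r \<inter> side u v)"
      using act_side[OF gC V] ray_V[OF r] by auto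
    then have "finite (range (fst g \<circ> r) \<inter> side (fst g u) (fst g v))"
      using uv finite_subset by blast
    then show "(fst g u, fst g v) \<in> ?F"
      using fin_equiv[OF s] act_E[OF gC] uv by blast
  qed auto
  \<comment> \<open>The first edge of the ray, traversed backwards: an injective ray cannot come
    back across it, so only \<open>r 0\<close> lies beyond.\<close>
  moreover have "(r 1, r 0) \<in> ?F"
  proof -
    have e: "(r 0, r 1) \<in> E" using ray_E[OF r, of 0] by simp
    have "r n \<notin> side (r 1) (r 0)" if "n > 0" for n
      using that
    proof (induction n rule: nat_induct_non_zero)
      case 1
      then show ?case using side_compl[OF e] side_head[OF e] E_V e by blast
    next
      case (Suc n)
      have "r (Suc n) \<noteq> r 0" using r by (auto simp: rays_def inj_def)
      then show ?case
        using side_crossing[OF E_sym[OF e] ray_E[OF r, of n]] side_compl[OF e] Suc ray_V[OF r] by blast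
    qed
    then have "range r \<inter> side (r 1) (r 0) \<subseteq> {r 0}" by (auto, metis gr0I)
    then show ?thesis using e E_sym finite_subset by blast
  qed
  ultimately show False by blast
qed

lemma no_flow_dense:
  assumes "subgroup G (Aut T)" "no_flow G"
  shows "geometrically_dense T G"
  unfolding geometrically_dense_def
proof (intro conjI notI; elim exE conjE)
  fix W B
  assume "subtree T W B" "(W, B) \<noteq> (V, arcs T)" "\<forall>g\<in>G. fst g ` W = W \<and> snd g ` B = B"
  then show False using no_flow_subtree[OF assms, of W B] by simp
next
  fix \<epsilon>
  assume "\<epsilon> \<in> ends T" "\<forall>g\<in>G. (\<lambda>r. fst g \<circ> r) ` \<epsilon> = \<epsilon>"
  then show False using no_flow_end[OF assms, of \<epsilon>] by simp
qed

end

subsection \<open>Quotient graphs\<close>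

locale tree_action = tree_graph T for T :: "('v, 'a) arc_graph" +
  fixes G :: "(('v \<Rightarrow> 'v) \<times> ('a \<Rightarrow> 'a)) set"
  assumes G: "subgroup G (Aut T)"
begin

abbreviation "Q \<equiv> quotient_graph T G"
abbreviation "vo \<equiv> vert_orbit T G"
abbreviation "ao \<equiv> arc_orbit T G"

lemma G_C: "g \<in> G \<Longrightarrow> g \<in> C"
  using subgroup.subset[OF G] by blast

lemma G_one: "e1 \<in> G"
  using subgroup.one_closed[OF G] .

lemma G_mult: "g \<in> G \<Longrightarrow> h \<in> G \<Longrightarrow> g \<bullet> h \<in> G"
  using subgroup.m_closed[OF G] .

lemma G_inv: "g \<in> G \<Longrightarrow> iv g \<in> G"
  using subgroup.m_inv_closed[OF G] .

lemma vo_eq: "vo v = (\<lambda>g. fst g v) ` G"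
  unfolding orbit_def Setcompr_eq_image by simp

lemma ao_eq: "ao a = (\<lambda>g. snd g a) ` G"
  unfolding orbit_def Setcompr_eq_image by simp

lemma vo_self: "v \<in> V \<Longrightarrow> v \<in> vo v"
  unfolding vo_eq using G_one act_one by (metis image_eqI)

lemma ao_self: "a \<in> arcs T \<Longrightarrow> a \<in> ao a"
  unfolding ao_eq using G_one act_one_arcs by (metis image_eqI)

lemma act_inv_arcs: "g \<in> C \<Longrightarrow> a \<in> arcs T \<Longrightarrow> snd (iv g) (snd g a) = a"
  using act_mult_arcs[of "iv g" g a] by simp

lemma vo_act: assumes "g \<in> G" "v \<in> V" shows "vo (fst g v) = vo v"
proof -
  have "fst h (fst g v) \<in> vo v" if "h \<in> G" for h
    unfolding vo_eq using act_mult[of h g v] G_mult[OF that assms(1)] G_C that assms by (metis image_eqI)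
  moreover have "fst h v \<in> vo (fst g v)" if "h \<in> G" for h
  proof -
    have "fst h v = fst (h \<bullet> iv g) (fst g v)" using assms that G_C by simp
    then show ?thesis unfolding vo_eq using G_mult[OF that G_inv[OF assms(1)]] by blast
  qed
  ultimately show ?thesis unfolding vo_eq[of v] vo_eq[of "fst g v"] by (auto simp: vo_eq)
qed

lemma ao_act: assumes "g \<in> G" "a \<in> arcs T" shows "ao (snd g a) = ao a"
proof -
  have "snd h (snd g a) \<in> ao a" if "h \<in> G" for h
    unfolding ao_eq using act_mult_arcs[of h g a] G_mult[OF that assms(1)] G_C that assms by (metis image_eqI)
  moreover have "snd h a \<in> ao (snd g a)" if "h \<in> G" for h
  proof -
    have "snd h a = snd (h \<bullet> iv g) (snd g a)"
      using assms that G_C act_inv_arcs act_mult_arcs[of h "iv g" "snd g a"] act_arcs by simp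
    then show ?thesis unfolding ao_eq using G_mult[OF that G_inv[OF assms(1)]] by blast
  qed
  ultimately show ?thesis unfolding ao_eq[of a] ao_eq[of "snd g a"] by (auto simp: ao_eq)
qed

lemma vo_eqD: assumes "u \<in> V" "vo u = vo v" shows "\<exists>g\<in>G. u = fst g v"
  using vo_self[OF assms(1)] assms(2) by (auto simp: vo_eq)

lemma vo_mem: assumes "w \<in> vo v" "v \<in> V" shows "vo w = vo v"
proof -
  obtain g where "g \<in> G" "w = fst g v" using assms(1) unfolding vo_eq by blast
  then show ?thesis using vo_act assms(2) by simp
qed

lemma ao_eqD: assumes "a \<in> arcs T" "ao a = ao b" shows "\<exists>g\<in>G. a = snd g b"
  using ao_self[OF assms(1)] assms(2) by (auto simp: ao_eq)

lemma Q_simps [simp]: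
  "verts Q = vo ` V" "arcs Q = ao ` arcs T" "origin Q = (\<lambda>A. origin T ` A)"
  "reversal Q = (\<lambda>A. reversal T ` A)"
  by (simp_all add: quotient_graph_def)

lemma Q_origin: assumes "a \<in> arcs T" shows "origin T ` ao a = vo (origin T a)"
proof -
  have "origin T (snd g a) = fst g (origin T a)" if "g \<in> G" for g
    using C_D(3)[OF G_C[OF that] assms] .
  then show ?thesis unfolding vo_eq ao_eq by force
qed

lemma Q_reversal: assumes "a \<in> arcs T" shows "reversal T ` ao a = ao (reversal T a)"
proof -
  have "reversal T (snd g a) = snd g (reversal T a)" if "g \<in> G" for g
    using C_D(4)[OF G_C[OF that] assms] .
  then show ?thesis unfolding ao_eq by force
qed

lemma Q_terminus: "a \<in> arcs T \<Longrightarrow> terminus Q (ao a) = vo (terminus T a)"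
  by (simp add: terminus_def Q_reversal Q_origin reversal_arcs)

lemma act_arcs_from: assumes "g \<in> G" "v \<in> V"
  shows "arcs_from T (fst g v) = snd g ` arcs_from T v"
proof
  note gC = G_C[OF assms(1)]
  show "snd g ` arcs_from T v \<subseteq> arcs_from T (fst g v)"
    using act_arcs[OF gC] C_D(3)[OF gC] by (auto simp: arcs_from_def)
  show "arcs_from T (fst g v) \<subseteq> snd g ` arcs_from T v"
  proof
    fix a assume a: "a \<in> arcs_from T (fst g v)"
    then have aA: "a \<in> arcs T" "origin T a = fst g v" by (auto simp: arcs_from_def)
    have iC: "iv g \<in> C" using gC by simp
    have "snd (iv g) a \<in> arcs_from T v"
      using act_arcs[OF iC] C_D(3)[OF iC aA(1)] aA assms gC by (auto simp: arcs_from_def)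
    moreover have "a = snd g (snd (iv g) a)"
      using act_mult_arcs[OF gC iC aA(1)] gC aA by simp
    ultimately show "a \<in> snd g ` arcs_from T v" by blast
  qed
qed

lemma act_inj_arcs: assumes "g \<in> C" shows "inj_on (snd g) (arcs T)"
  using C_D(2)[OF assms] by (simp add: Bij_def bij_betw_def)

lemma card_arcs_from_orbit: assumes "u \<in> V" "v \<in> V" "vo u = vo v"
  shows "card (arcs_from T u) = card (arcs_from T v)"
proof -
  obtain g where g: "g \<in> G" "u = fst g v" using vo_eqD assms by blast
  have "inj_on (snd g) (arcs_from T v)"
    using act_inj_arcs[OF G_C[OF g(1)]] by (rule inj_on_subset) (auto simp: arcs_from_def)
  then show ?thesis using act_arcs_from[OF g(1) assms(2)] g(2) by (simp add: card_image)
qed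

text \<open>An arc orbit starting in the orbit of \<open>v\<close> has a member that starts at
  \<open>v\<close> itself. Degrees in the quotient are thus counted by arc orbits at a single
  vertex.\<close>

lemma Q_arcs_from: assumes "v \<in> V" shows "arcs_from Q (vo v) = ao ` arcs_from T v"
proof
  have "ao a \<in> arcs_from Q (vo v)" if "a \<in> arcs_from T v" for a
    using that Q_origin[of a] by (simp add: arcs_from_def)
  then show "ao ` arcs_from T v \<subseteq> arcs_from Q (vo v)" by blast
  show "arcs_from Q (vo v) \<subseteq> ao ` arcs_from T v"
  proof
    fix A assume "A \<in> arcs_from Q (vo v)"
    then obtain a where a: "a \<in> arcs T" "A = ao a" "vo (origin T a) = vo v"
      by (auto simp: arcs_from_def Q_origin)
    then obtain g where g: "g \<in> G" "v = fst g (origin T a)" using vo_eqD assms by metis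
    then have "snd g a \<in> arcs_from T v"
      using act_arcs[OF G_C[OF g(1)] a(1)] C_D(3)[OF G_C[OF g(1)] a(1)] by (simp add: arcs_from_def)
    then show "A \<in> ao ` arcs_from T v" using ao_act[OF g(1) a(1)] a by blast
  qed
qed

lemma Q_connected: "connected_graph Q"
  unfolding connected_graph_def
proof (intro conjI ballI)
  show "wf_graph Q"
    unfolding wf_graph_def
    by (auto simp: Q_origin Q_reversal origin_V reversal_arcs reversal_reversal)
  show "verts Q \<noteq> {}" using V_nonempty by simp
  fix x y assume "x \<in> verts Q" "y \<in> verts Q"
  then obtain u v where uv: "u \<in> V" "v \<in> V" "x = vo u" "y = vo v" by auto
  have "(u, v) \<in> E\<^sup>*" using E_connected uv by blast
  then have "(vo u, vo v) \<in> (adj Q)\<^sup>*"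
  proof (induction rule: rtrancl_induct)
    case (step y z)
    then obtain a where a: "a \<in> arcs T" "y = origin T a" "z = terminus T a" by (auto simp: adj_def)
    then have "(vo y, vo z) = (origin Q (ao a), terminus Q (ao a))"
      using Q_origin Q_terminus by simp
    then have "(vo y, vo z) \<in> adj Q" unfolding adj_def using a(1) by auto
    then show ?case using step.IH by (rule rtrancl_into_rtrancl[rotated])
  qed simp
  then show "(x, y) \<in> (adj Q)\<^sup>*" using uv by simp
qed

text \<open>Phrased in \<open>T\<close> alone, without a diagram. Since \<open>card\<close> is 0 for
  infinite sets, the inequality also admits vertices of infinite degree.\<close>

definition no_stray :: bool where
  "no_stray \<longleftrightarrow> (\<forall>v\<in>V. leaf Q (vo v) \<longrightarrow> card (arcs_from T v) \<noteq> 1)"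

text \<open>Sending an orbit of flow arcs to its terminus is a bijection onto the orbits in
  \<open>U\<close>, and sending it to its origin covers these orbits. Finiteness turns this covering
  into a bijection, which determines the quotient.\<close>

lemma flow_imp_cycle_graph:
  assumes fin: "finite_graph Q" and us: no_stray and F: "flow G F" and ne: "F \<noteq> {}"
  shows "cycle_graph Q"
proof -
  define FA where "FA = {a \<in> arcs T. (origin T a, terminus T a) \<in> F}"
  define U where "U = terminus T ` FA"
  have FE: "F \<subseteq> E" and F1: "\<And>u v w. (u, v) \<in> F \<Longrightarrow> (v, w) \<in> E \<Longrightarrow> w \<noteq> u \<Longrightarrow> (v, w) \<in> F"
    and F2: "\<And>u v. (u, v) \<in> F \<Longrightarrow> (v, u) \<notin> F"
    and F3: "\<And>g u v. g \<in> G \<Longrightarrow> (u, v) \<in> F \<Longrightarrow> (fst g u, fst g v) \<in> F"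
    using F unfolding flow_def by blast+
  have FA_arcs: "a \<in> FA \<Longrightarrow> a \<in> arcs T" for a by (simp add: FA_def)
  have tr: "terminus T (reversal T a) = origin T a" "origin T (reversal T a) = terminus T a"
    if "a \<in> arcs T" for a using that reversal_reversal by (auto simp: terminus_def)
  have FA_rev: "reversal T a \<notin> FA" if "a \<in> FA" for a
    using that F2 tr[OF FA_arcs[OF that]] by (auto simp: FA_def)
  have FA_act: "snd g a \<in> FA" if "g \<in> G" "a \<in> FA" for g a
    using that F3 act_arcs[OF G_C[OF that(1)]] C_D(3)[OF G_C[OF that(1)]] act_terminus[OF G_C[OF that(1)]]
    by (auto simp: FA_def)
  have FA_step: "b \<in> FA \<or> b = reversal T a"
    if "a \<in> FA" "b \<in> arcs T" "origin T b = terminus T a" for a b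
  proof (cases "terminus T b = origin T a")
    case True
    then have "b = reversal T a"
      using arc_eqI[OF that(2) reversal_arcs[OF FA_arcs[OF that(1)]]] tr[OF FA_arcs[OF that(1)]] that(3)
      by simp
    then show ?thesis ..
  next
    case False
    then have "(origin T b, terminus T b) \<in> F"
      using F1[of "origin T a" "terminus T a" "terminus T b"] that arc_E[OF that(2)] by (auto simp: FA_def)
    then show ?thesis using that by (simp add: FA_def)
  qed
  \<comment> \<open>Otherwise the reverse of \<open>b\<close>, which leaves the terminus of
    \<open>a\<close>, would belong to the flow together with \<open>b\<close>.\<close>
  have FA_inj: "a = b" if "a \<in> FA" "b \<in> FA" "terminus T a = terminus T b" for a b
  proof -
    have "reversal T b \<in> FA \<or> reversal T b = reversal T a"
      using FA_step[OF that(1), of "reversal T b"] reversal_arcs tr that FA_arcs by simp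
    then show ?thesis using FA_rev that reversal_reversal FA_arcs by metis
  qed
  have U_V: "U \<subseteq> V" unfolding U_def FA_def using arc_E E_V by blast
  have U_act: "fst g u \<in> U" if "g \<in> G" "u \<in> U" for g u
  proof -
    obtain a where a: "a \<in> FA" "u = terminus T a" using \<open>u \<in> U\<close> by (auto simp: U_def)
    then show ?thesis
      using act_terminus[OF G_C[OF that(1)] FA_arcs[OF a(1)]] FA_act[OF that(1) a(1)] unfolding U_def by force
  qed
  \<comment> \<open>If no flow arc leaves \<open>v\<close>, then \<open>v\<close> has degree one in
    \<open>T\<close>. Its orbit is not a leaf, so its quotient arc is a loop; then some
    \<open>g\<close> reverses \<open>a\<close>, against the invariance of the flow.\<close>
  have out: "\<exists>a\<in>FA. origin T a = v" if v: "v \<in> U" for v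
  proof (rule ccontr)
    assume no: "\<not> (\<exists>a\<in>FA. origin T a = v)"
    obtain a where a: "a \<in> FA" "v = terminus T a" using \<open>v \<in> U\<close> by (auto simp: U_def)
    note aA = FA_arcs[OF a(1)]
    have one: "arcs_from T v = {reversal T a}"
      using FA_step[OF a(1)] no a(2) reversal_arcs[OF aA] tr[OF aA] by (auto simp: arcs_from_def)
    then have "\<not> leaf Q (vo v)" using us U_V that unfolding no_stray_def by auto
    moreover have "arcs_from Q (vo v) = {ao (reversal T a)}" using one Q_arcs_from U_V that by auto
    ultimately have "is_loop Q (ao (reversal T a))"
      using that U_V unfolding leaf_def by auto
    then have "vo (origin T a) = vo v"
      using Q_terminus[OF reversal_arcs[OF aA]] tr[OF aA] a(2) Q_origin[OF reversal_arcs[OF aA]]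
      by (simp add: is_loop_def)
    then obtain g where g: "g \<in> G" "origin T a = fst g v" using vo_eqD origin_V[OF aA] by blast
    have "a \<in> arcs_from T (fst g v)" using aA g by (simp add: arcs_from_def)
    then have "a = snd g (reversal T a)" using act_arcs_from[OF g(1)] U_V that one by auto
    then have "reversal T a = snd g a"
      using C_D(4)[OF G_C[OF g(1)] reversal_arcs[OF aA]] reversal_reversal[OF aA] by simp
    then show False using FA_act[OF g(1) a(1)] FA_rev[OF a(1)] by simp
  qed
  have finA: "finite (ao ` X)" if "X \<subseteq> arcs T" for X
    using fin finite_subset[OF image_mono[OF that, of ao]] unfolding finite_graph_def by simp
  \<comment> \<open>\<open>?A'\<close> consists of the orbits of flow arcs that also start in
    \<open>U\<close>. Below, \<open>card ?A = card ?U\<close> and \<open>?U\<close> is covered by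
    the origins of \<open>?A'\<close>, so by finiteness \<open>?A'\<close> is all of
    \<open>?A\<close> and the origin map is injective on it.\<close>
  let ?A = "ao ` FA" and ?A' = "ao ` {a \<in> FA. origin T a \<in> U}" and ?U = "vo ` U"
  have FAs: "FA \<subseteq> arcs T" by (auto simp: FA_def)
  have "terminus Q ` ?A = ?U"
    using Q_terminus FA_arcs unfolding U_def image_image by (simp add: image_def)
  moreover have "inj_on (terminus Q) ?A"
  proof (rule inj_onI; clarify)
    fix a b assume ab: "a \<in> FA" "b \<in> FA" "terminus Q (ao a) = terminus Q (ao b)"
    then have "vo (terminus T a) = vo (terminus T b)" using Q_terminus FA_arcs by simp
    then obtain g where g: "g \<in> G" "terminus T a = fst g (terminus T b)"
      using vo_eqD U_V ab unfolding U_def by blast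
    then have "a = snd g b"
      using FA_inj[OF ab(1) FA_act[OF g(1) ab(2)]] act_terminus[OF G_C[OF g(1)] FA_arcs[OF ab(2)]] by simp
    then show "ao a = ao b" using ao_act g(1) FA_arcs[OF ab(2)] by simp
  qed
  ultimately have card1: "card ?U = card ?A" by (metis card_image)
  have surj: "?U \<subseteq> origin Q ` ?A'"
  proof
    fix x assume "x \<in> ?U"
    then obtain v where v: "v \<in> U" "x = vo v" by blast
    then obtain a where a: "a \<in> FA" "origin T a = v" using out by blast
    then have "origin Q (ao a) = x" using Q_origin FA_arcs v by simp
    then show "x \<in> origin Q ` ?A'" using a v by blast
  qed
  have fA: "finite ?A" using finA[OF FAs] .
  have fA': "finite ?A'" by (rule finA) (use FAs in blast)
  have "card ?A \<le> card (origin Q ` ?A')" using card_mono[OF finite_imageI[OF fA'] surj] card1 by simp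
  also have "\<dots> \<le> card ?A'" using card_image_le[OF fA'] .
  finally have cA: "card ?A \<le> card ?A'" .
  have sub: "?A' \<subseteq> ?A" by blast
  have AA: "?A' = ?A" using card_seteq[OF fA sub cA] .
  have "card (origin Q ` ?A) = card ?A"
    using \<open>card ?A \<le> card (origin Q ` ?A')\<close> card_image_le[OF fA, of "origin Q"] AA by simp
  then have oinj: "inj_on (origin Q) ?A" using eq_card_imp_inj_on[OF fA] by blast
  have org: "origin T a \<in> U" if a: "a \<in> FA" for a
  proof -
    have "ao a \<in> ?A'" using a AA by blast
    then obtain b where b: "b \<in> FA" "origin T b \<in> U" "ao a = ao b" by blast
    then obtain g where g: "g \<in> G" "a = snd g b" using ao_eqD FA_arcs[OF a] by blast
    then show ?thesis using U_act b C_D(3)[OF G_C[OF g(1)] FA_arcs[OF b(1)]] by simp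
  qed
  obtain a0 where "a0 \<in> FA" using ne FE unfolding FA_def adj_def by blast
  then have "terminus T a0 \<in> U" by (simp add: U_def)
  \<comment> \<open>\<open>U\<close> is closed under passing to neighbours: an arc leaving
    \<open>v\<close> is a flow arc or leads back to the origin of a flow arc, which lies in
    \<open>U\<close> by \<open>org\<close>.\<close>
  moreover have Ucl: "w \<in> U" if "v \<in> U" "(v, w) \<in> E" for v w
  proof -
    obtain a where a: "a \<in> FA" "v = terminus T a" using \<open>v \<in> U\<close> by (auto simp: U_def)
    obtain b where b: "b \<in> arcs T" "v = origin T b" "w = terminus T b" using \<open>(v, w) \<in> E\<close> by (auto simp: adj_def)
    from FA_step[OF a(1) b(1)] a b have "b \<in> FA \<or> b = reversal T a" by simp
    then show ?thesis
    proof
      assume "b \<in> FA" then show ?thesis using b by (simp add: U_def)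
    next
      assume "b = reversal T a" then show ?thesis using b tr[OF FA_arcs[OF a(1)]] org[OF a(1)] by simp
    qed
  qed
  ultimately have UV: "U = V"
  proof -
    have "w \<in> U" if "w \<in> V" for w
    proof (rule ccontr)
      assume "w \<notin> U"
      have "(terminus T a0, w) \<in> E\<^sup>*" using E_connected U_V \<open>terminus T a0 \<in> U\<close> that by blast
      from rtrancl_crossing[OF this \<open>terminus T a0 \<in> U\<close> \<open>w \<notin> U\<close>] Ucl show False by blast
    qed
    then show ?thesis using U_V by blast
  qed
  \<comment> \<open>At \<open>v\<close> there are the reverse of the unique incoming flow arc and
    the outgoing flow arcs; the latter form one orbit by \<open>oinj\<close>, and invariance of the
    flow separates the two orbits.\<close>
  have "card (arcs_from Q x) = 2" if "x \<in> verts Q" for x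
  proof -
    obtain v where v: "v \<in> V" "x = vo v" using \<open>x \<in> verts Q\<close> by auto
    then obtain a where a: "a \<in> FA" "v = terminus T a" using UV by (auto simp: U_def)
    obtain b where b: "b \<in> FA" "origin T b = v" using out v UV by blast
    have "arcs_from T v = {reversal T a} \<union> {c \<in> FA. origin T c = v}"
      using FA_step[OF a(1)] a(2) reversal_arcs[OF FA_arcs[OF a(1)]] tr[OF FA_arcs[OF a(1)]] FA_arcs
      by (auto simp: arcs_from_def)
    then have "ao ` arcs_from T v = insert (ao (reversal T a)) (ao ` {c \<in> FA. origin T c = v})" by simp
    moreover have "ao c = ao b" if c: "c \<in> FA" "origin T c = v" for c
    proof -
      have "origin Q (ao c) = origin Q (ao b)"
        using Q_origin[OF FA_arcs[OF c(1)]] Q_origin[OF FA_arcs[OF b(1)]] c b by simp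
      then show ?thesis using inj_onD[OF oinj] c b by blast
    qed
    then have "ao ` {c \<in> FA. origin T c = v} = {ao b}" using b by blast
    ultimately have "arcs_from Q x = {ao (reversal T a), ao b}"
      using Q_arcs_from[OF v(1)] v(2) by simp
    moreover have "ao (reversal T a) \<noteq> ao b"
      using ao_eqD[OF reversal_arcs[OF FA_arcs[OF a(1)]], of b] FA_act[OF _ b(1)] FA_rev[OF a(1)] by auto
    ultimately show ?thesis by simp
  qed
  \<comment> \<open>Since \<open>U = V\<close>, exactly one of \<open>a\<close> and its reverse is a
    flow arc, so no element of \<open>G\<close> interchanges them.\<close>
  moreover have "reversal Q A \<noteq> A" if "A \<in> arcs Q" for A
  proof
    assume rA: "reversal Q A = A"
    obtain a where a: "a \<in> arcs T" "A = ao a" using \<open>A \<in> arcs Q\<close> by auto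
    have e: "ao (reversal T a) = ao a" using rA Q_reversal a by simp
    obtain b where b: "b \<in> FA" "origin T a = terminus T b" using origin_V[OF a(1)] UV by (auto simp: U_def)
    obtain g where g: "g \<in> G" "reversal T a = snd g a" using ao_eqD[OF reversal_arcs[OF a(1)] e] by blast
    obtain h where h: "h \<in> G" "a = snd h (reversal T a)" using ao_eqD[OF a(1) e[symmetric]] by blast
    from FA_step[OF b(1) a(1) b(2)] show False
    proof
      assume "a \<in> FA" then show False using FA_act[OF g(1)] FA_rev g(2) by metis
    next
      assume "a = reversal T b"
      then have "reversal T a \<in> FA" using b reversal_reversal FA_arcs by simp
      then show False using FA_act[OF h(1)] FA_rev h(2) reversal_reversal[OF a(1)] by metis
    qed
  qed
  ultimately show ?thesis unfolding cycle_graph_def using fin Q_connected by blast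
qed

lemma no_flowI:
  assumes "finite_graph Q" "\<not> cycle_graph Q" no_stray
  shows "no_flow G"
  using flow_imp_cycle_graph assms unfolding no_flow_def by blast

text \<open>The orbit of \<open>v\<close> consists of vertices of degree one in \<open>T\<close>,
  and deleting all of them leaves an invariant proper subtree.\<close>

lemma dense_imp_no_stray:
  assumes gd: "geometrically_dense T G"
  shows no_stray
  unfolding no_stray_def
proof (intro ballI impI notI)
  fix v assume v: "v \<in> V" and leaf: "leaf Q (vo v)" and one: "card (arcs_from T v) = 1"
  obtain a where a: "arcs_from T v = {a}" using one by (auto simp: card_1_singleton_iff)
  then have aA: "a \<in> arcs T" "origin T a = v" by (auto simp: arcs_from_def)
  let ?W = "V - vo v"
  let ?B = "{b \<in> arcs T. origin T b \<in> ?W \<and> terminus T b \<in> ?W}"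
  have uniq: "x = y" if "w \<in> vo v" "(w, x) \<in> E" "(w, y) \<in> E" for w x y
  proof -
    obtain g where g: "g \<in> G" "w = fst g v" using \<open>w \<in> vo v\<close> unfolding vo_eq by blast
    then have w: "arcs_from T w = {snd g a}" using act_arcs_from[OF g(1) v] a by simp
    obtain b c where bc: "b \<in> arcs T" "c \<in> arcs T" "w = origin T b" "w = origin T c" "x = terminus T b"
        "y = terminus T c"
      using \<open>(w, x) \<in> E\<close> \<open>(w, y) \<in> E\<close> unfolding adj_def by blast
    then have "b \<in> arcs_from T w" "c \<in> arcs_from T w" by (auto simp: arcs_from_def)
    then show ?thesis using w bc by simp
  qed
  have vo_V: "vo v \<subseteq> V" using act_V[OF G_C v] unfolding vo_eq by blast
  have vo_cl: "fst g w \<in> vo v" if "g \<in> G" "w \<in> vo v" for g w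
  proof -
    have "w \<in> V" using vo_V that by blast
    then have "fst g w \<in> vo (fst g w)" using vo_self G_C that by simp
    moreover have "vo (fst g w) = vo v"
      using vo_act[OF that(1) \<open>w \<in> V\<close>] vo_mem[OF that(2) v] by simp
    ultimately show ?thesis by simp
  qed
  have W_cl: "fst g w \<in> ?W" if g: "g \<in> G" and w: "w \<in> ?W" for g w
  proof -
    have "fst g w \<notin> vo v"
    proof
      assume "fst g w \<in> vo v"
      then have "fst (iv g) (fst g w) \<in> vo v" using vo_cl[OF G_inv[OF g]] by blast
      then show False using w G_C[OF g] by simp
    qed
    then show ?thesis using w G_C[OF g] by simp
  qed
  have W_im: "fst g ` ?W = ?W" if g: "g \<in> G" for g
  proof
    show "fst g ` ?W \<subseteq> ?W" using W_cl[OF g] by blast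
    show "?W \<subseteq> fst g ` ?W"
    proof
      fix w assume w: "w \<in> ?W"
      then have "w = fst g (fst (iv g) w)" using G_C[OF g] by simp
      then show "w \<in> fst g ` ?W" using W_cl[OF G_inv[OF g] w] by blast
    qed
  qed
  have B_cl: "snd g b \<in> ?B" if g: "g \<in> G" and b: "b \<in> ?B" for g b
    using W_cl[OF g] b act_arcs[OF G_C[OF g]] C_D(3)[OF G_C[OF g]] act_terminus[OF G_C[OF g]] by auto
  have B_im: "snd g ` ?B = ?B" if g: "g \<in> G" for g
  proof
    show "snd g ` ?B \<subseteq> ?B" using B_cl[OF g] by blast
    show "?B \<subseteq> snd g ` ?B"
    proof
      fix b assume b: "b \<in> ?B"
      then have "b = snd g (snd (iv g) b)"
        using G_C[OF g] act_mult_arcs[of g "iv g" b] by simp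
      then show "b \<in> snd g ` ?B" using B_cl[OF G_inv[OF g] b] by blast
    qed
  qed
  let ?S = "T\<lparr>verts := ?W, arcs := ?B\<rparr>"
  have adjS: "adj ?S = E \<inter> ?W \<times> ?W"
    by (auto simp: adj_def terminus_def)
  \<comment> \<open>The arc at a leaf of the quotient is not a loop, so the neighbour of
    \<open>v\<close> survives the deletion and \<open>?W\<close> is nonempty.\<close>
  have "terminus T a \<notin> vo v"
  proof
    assume "terminus T a \<in> vo v"
    then have "vo (terminus T a) = vo v" using vo_mem v by blast
    then have "is_loop Q (ao a)" using Q_terminus[OF aA(1)] Q_origin[OF aA(1)] aA by (simp add: is_loop_def)
    moreover have "ao a \<in> arcs_from Q (vo v)" using Q_arcs_from[OF v] a by simp
    ultimately show False using leaf by (simp add: leaf_def)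
  qed
  then have W0: "?W \<noteq> {}" using E_V[OF arc_E[OF aA(1)]] by blast
  have con: "(x, y) \<in> (adj ?S)\<^sup>*" if x: "x \<in> ?W" and y: "y \<in> ?W" for x y
    using y
  proof (induction "d x y" arbitrary: y)
    case 0
    then show ?case using dist_0 x by auto
  next
    case (Suc n)
    have "y \<noteq> x" using Suc by auto
    then obtain z where z: "(z, y) \<in> E" "d x y = d x z + 1" using dist_closer Suc x by (metis DiffD1)
    have zV: "z \<in> V" using E_V z by blast
    \<comment> \<open>A deleted \<open>z\<close> is not \<open>x\<close>, so the geodesic from
      \<open>x\<close> to \<open>y\<close> gives it two neighbours at different distances from
      \<open>x\<close>, whereas it has only one.\<close>
    have "z \<notin> vo v"
    proof
      assume zv: "z \<in> vo v"
      then have "z \<noteq> x" using x by blast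
      then obtain z' where z': "(z', z) \<in> E" "d x z = d x z' + 1" using dist_closer zV x by blast
      have "y = z'" using uniq[OF zv z(1) E_sym[OF z'(1)]] .
      then show False using z z' by simp
    qed
    then have "(x, z) \<in> (adj ?S)\<^sup>*" using Suc z zV by simp
    moreover have "(z, y) \<in> adj ?S" unfolding adjS using z zV \<open>z \<notin> vo v\<close> Suc by blast
    ultimately show ?case by simp
  qed
  have "wf_graph ?S"
    using reversal_arcs reversal_reversal by (auto simp: wf_graph_def terminus_def)
  then have "subtree T ?W ?B"
    unfolding subtree_def connected_graph_def using W0 con by auto
  moreover have "(?W, ?B) \<noteq> (V, arcs T)" using vo_self[OF v] v by blast
  ultimately show False using gd W_im B_im unfolding geometrically_dense_def by blast
qed

end

context tree_graph
begin

subsection \<open>Axes\<close>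

lemma relpow_crossing:
  assumes "(a, b) \<in> R ^^ n" "a \<in> P" "b \<notin> P"
  shows "\<exists>i j u v. n = i + 1 + j \<and> (a, u) \<in> R ^^ i \<and> (u, v) \<in> R \<and> (v, b) \<in> R ^^ j \<and> u \<in> P \<and> v \<notin> P"
  using assms
proof (induction n arbitrary: a)
  case (Suc n)
  obtain c where c: "(a, c) \<in> R" "(c, b) \<in> R ^^ n" using Suc.prems(1) by (meson relpow_Suc_E2)
  show ?case
  proof (cases "c \<in> P")
    case True
    then obtain i j u v where "n = i + 1 + j" "(c, u) \<in> R ^^ i" "(u, v) \<in> R" "(v, b) \<in> R ^^ j" "u \<in> P" "v \<notin> P"
      using Suc.IH c(2) Suc.prems(3) by blast
    moreover have "(a, u) \<in> R ^^ Suc i" using calculation c(1) by (meson relpow_Suc_I2)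
    ultimately show ?thesis
      by (intro exI[of _ "Suc i"] exI[of _ j] exI[of _ u] exI[of _ v]) simp
  next
    case False
    then show ?thesis using c Suc.prems(2)
      by (intro exI[of _ 0] exI[of _ n] exI[of _ a] exI[of _ c]) simp
  qed
qed simp

text \<open>A shortest walk must pass from one half-tree to the other, and by
  \<open>side_crossing\<close> it can do so only along \<open>(u, v)\<close>.\<close>

lemma dist_through_edge:
  assumes uv: "(u, v) \<in> E" and x: "x \<in> side v u" and y: "y \<in> side u v"
  shows "d x y = d x u + 1 + d v y"
proof -
  have V: "x \<in> V" "y \<in> V" "u \<in> V" "v \<in> V" using x y side_V E_V[OF uv] by auto
  have "y \<notin> side v u" using side_compl[OF uv V(2)] y by blast
  from relpow_crossing[OF dist_relpow[OF V(1,2)] x this]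
  obtain i j a b where ij: "d x y = i + 1 + j" "(x, a) \<in> E ^^ i" "(a, b) \<in> E" "(b, y) \<in> E ^^ j"
    "a \<in> side v u" "b \<notin> side v u" by blast
  have "b \<in> side u v" using side_compl[OF uv] ij(6) E_V[OF ij(3)] by blast
  then have "a = u" "b = v" using side_crossing[OF uv ij(3,5)] by auto
  then have "d x u + 1 + d v y \<le> d x y" using ij(1) dist_le[OF ij(2)] dist_le[OF ij(4)] by simp
  moreover have "d x y \<le> d x u + d u y" using dist_triangle V by blast
  moreover have "d u y = d v y + 1" using y by (simp add: side_def dist_sym)
  ultimately show ?thesis by linarith
qed

text \<open>Take for \<open>m\<close> a fixed vertex nearest to \<open>z\<close>. The neighbour of
  \<open>m\<close> towards \<open>z\<close> is moved, so the geodesics from \<open>m\<close> to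
  \<open>z\<close> and to its image leave \<open>m\<close> along different edges.\<close>

lemma fixed_midpoint:
  assumes h: "h \<in> C" and c: "c \<in> V" "fst h c = c" and z: "z \<in> V"
  shows "\<exists>m. fst h m = m \<and> between z m (fst h z) \<and> 2 * d z m = d z (fst h z)"
proof -
  define P where "P m \<longleftrightarrow> m \<in> V \<and> fst h m = m" for m
  have "P c" using c by (simp add: P_def)
  then obtain m where m: "P m" "\<And>x. P x \<Longrightarrow> d z m \<le> d z x"
    using ex_has_least_nat[of P c "d z"] by blast
  then have mV: "m \<in> V" and hm: "fst h m = m" by (auto simp: P_def)
  have hz: "d m (fst h z) = d m z" using act_dist[OF h mV z] hm by simp
  have "d z (fst h z) = d z m + d m (fst h z)"
  proof (cases "m = z")
    case True
    then show ?thesis using hm by simp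
  next
    case False
    then obtain b where b: "(b, m) \<in> E" "d z m = d z b + 1" using dist_closer z mV by metis
    have bV: "b \<in> V" using E_V b by blast
    have "\<not> P b" using m(2)[of b] b(2) by linarith
    then have hb: "fst h b \<noteq> b" using bV by (simp add: P_def)
    have e: "(m, fst h b) \<in> E" using act_E[OF h b(1)] hm E_sym by simp
    have zs: "z \<in> side m b" using b z by (simp add: side_def)
    then have "fst h z \<in> side m (fst h b)" using act_side[OF h mV bV z] hm by simp
    then have "fst h z \<in> side b m" using side_step[OF b(1) e hb] by blast
    then show ?thesis using dist_through_edge[OF b(1) zs] b(2) by simp
  qed
  then show ?thesis using hm hz mV dist_sym[of m z] by (intro exI[of _ m]) (simp add: between_def)
qed

text \<open>If \<open>h\<close> moved \<open>b\<close>, the fixed vertex \<open>z\<close> would lie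
  in the half-trees beyond two different neighbours of \<open>a\<close>.\<close>

lemma fixed_step:
  assumes h: "h \<in> C" and ab: "(a, b) \<in> E" and a: "fst h a = a" and z: "z \<in> side a b" "fst h z = z"
  shows "fst h b = b"
proof (rule ccontr)
  assume hb: "fst h b \<noteq> b"
  have V: "a \<in> V" "b \<in> V" "z \<in> V" using E_V[OF ab] z(1) side_V by auto
  have e: "(a, fst h b) \<in> E" using act_E[OF h ab] a by simp
  have "z \<in> side a (fst h b)" using act_side[OF h V(1,2,3)] z a by simp
  then have "z \<in> side b a" using side_step[OF E_sym[OF ab] e hb] by blast
  then show False using side_compl[OF ab V(3)] z by blast
qed

text \<open>Excludes inversions of edges, so that an element without fixed vertex has an
  axis.\<close>

definition even_displacement :: "('v \<Rightarrow> 'v) \<times> ('a \<Rightarrow> 'a) \<Rightarrow> bool" where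
  "even_displacement h \<longleftrightarrow> (\<forall>v\<in>V. even (d v (fst h v)))"

definition axis :: "('v \<Rightarrow> 'v) \<times> ('a \<Rightarrow> 'a) \<Rightarrow> (int \<Rightarrow> 'v) \<Rightarrow> bool" where
  "axis h p \<longleftrightarrow> line p \<and> (\<exists>k>0. \<forall>i. fst h (p i) = p (i + k))"

text \<open>If every element of \<open>H\<close> fixes a vertex, the arcs beyond which some element
  of \<open>H\<close> fixes nothing form a flow. A nontrivial element would make this flow
  nonempty.\<close>

lemma elliptic_trivial:
  assumes G: "G \<subseteq> C" and nf: "no_flow G" and H: "subgroup H (Aut T)"
    and conj: "\<And>g h. g \<in> G \<Longrightarrow> h \<in> H \<Longrightarrow> g \<bullet> h \<bullet> iv g \<in> H"
    and fixpt: "\<And>h. h \<in> H \<Longrightarrow> \<exists>c\<in>V. fst h c = c"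
  shows "H = {e1}"
proof -
  have HC: "h \<in> C" if "h \<in> H" for h using subgroup.subset[OF H] that by blast
  define M where "M h u v \<longleftrightarrow> (\<forall>w\<in>V. fst h w = w \<longrightarrow> w \<notin> side u v)" for h :: "('v \<Rightarrow> 'v) \<times> ('a \<Rightarrow> 'a)" and u v
  let ?F = "{(u, v) \<in> E. \<exists>h\<in>H. M h u v}"
  have F0: "?F = {}"
  proof (rule no_flowD[OF nf])
    fix u v w assume "(u, v) \<in> ?F" "(v, w) \<in> E" "w \<noteq> u"
    then show "(v, w) \<in> ?F" using side_step[of u v w] unfolding M_def by blast
  next
    fix u v assume "(u, v) \<in> ?F" "(v, u) \<in> ?F"
    then obtain h h' where uv: "(u, v) \<in> E" and h: "h \<in> H" "M h u v" and h': "h' \<in> H" "M h' v u" by blast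
    have hh: "h \<bullet> h' \<in> H" using subgroup.m_closed[OF H] h h' by blast
    then obtain w where w: "w \<in> V" "fst (h \<bullet> h') w = w" using fixpt by blast
    \<comment> \<open>\<open>h'\<close> sends \<open>w\<close> to \<open>w'\<close> and
      \<open>h\<close> sends \<open>w'\<close> back, so the midpoint of the two is fixed by both and
      would lie in neither half-tree.\<close>
    define w' where "w' = fst h' w"
    have w'V: "w' \<in> V" using w HC[OF h'(1)] by (simp add: w'_def)
    have hw': "fst h w' = w" using w HC h h' by (simp add: w'_def)
    obtain c where "c \<in> V" "fst h' c = c" using fixpt h' by blast
    then obtain m' where m': "fst h' m' = m'" "between w m' w'" "2 * d w m' = d w w'"
      using fixed_midpoint[OF HC[OF h'(1)] _ _ w(1)] unfolding w'_def by blast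
    obtain c where "c \<in> V" "fst h c = c" using fixpt h by blast
    then obtain m where m: "fst h m = m" "between w' m w" "2 * d w' m = d w' w"
      using fixed_midpoint[OF HC[OF h(1)] _ _ w'V] unfolding hw' by blast
    have "between w m w'" using m(2) by (simp add: between_def dist_sym)
    moreover have "d w m' = d w m" using m m' by (auto simp: between_def dist_sym)
    ultimately have "m = m'" using between_unique[OF w(1) w'V m'(2)] by simp
    moreover have mV: "m \<in> V" using m(2) by (simp add: between_def)
    ultimately have "m \<notin> side u v" "m \<notin> side v u"
      using h(2) h'(2) m(1) m'(1) unfolding M_def by auto
    then show False using side_compl[OF uv mV] by blast
  next
    fix g u v assume g: "g \<in> G" and "(u, v) \<in> ?F"
    then obtain h where uv: "(u, v) \<in> E" and h: "h \<in> H" "M h u v" by blast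
    have gC: "g \<in> C" using g G by blast
    have "M (g \<bullet> h \<bullet> iv g) (fst g u) (fst g v)"
      unfolding M_def
    proof (intro ballI impI notI)
      fix w assume w: "w \<in> V" "fst (g \<bullet> h \<bullet> iv g) w = w" "w \<in> side (fst g u) (fst g v)"
      let ?w = "fst (iv g) w"
      have wV: "?w \<in> V" using w gC by simp
      have "fst g (fst h ?w) = w" using w gC HC[OF h(1)] by simp
      then have "fst h ?w = ?w" using act_inv(1)[OF gC, of "fst h ?w"] wV HC[OF h(1)] by simp
      moreover have "?w \<in> side u v" using act_side_inv[OF gC _ _ w(1)] E_V[OF uv] w(3) by blast
      ultimately show False using h(2) wV unfolding M_def by blast
    qed
    then show "(fst g u, fst g v) \<in> ?F" using conj[OF g h(1)] act_E[OF gC uv] by blast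
  qed auto
  have "h = e1" if h: "h \<in> H" for h
  proof (rule ccontr)
    assume "h \<noteq> e1"
    then obtain x where x: "x \<in> V" "fst h x \<noteq> x" using act_eqI[OF HC[OF h] A.one_closed] by auto
    obtain c where c: "c \<in> V" "fst h c = c" using fixpt h by blast
    have "(c, x) \<in> E\<^sup>*" using E_connected c x by blast
    \<comment> \<open>An edge from a fixed to a moved vertex; by \<open>fixed_step\<close>,
      \<open>h\<close> fixes nothing beyond it.\<close>
    then obtain a b where ab: "(a, b) \<in> E" "fst h a = a" "fst h b \<noteq> b"
      using rtrancl_crossing[of c x E "{y. fst h y = y}"] c x by blast
    have "M h a b" unfolding M_def using fixed_step[OF HC[OF h] ab(1,2)] ab(3) by blast
    then show False using F0 ab(1) h by blast
  qed
  then show ?thesis using subgroup.one_closed[OF H] by blast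
qed

text \<open>Choose \<open>z\<close> with the least displacement; the translates of a geodesic from
  \<open>z\<close> to its image under the powers of \<open>h\<close> fit together to a line.\<close>

lemma ex_axis:
  assumes h: "h \<in> C" and ev: "even_displacement h" and nofix: "\<And>v. v \<in> V \<Longrightarrow> fst h v \<noteq> v"
  shows "\<exists>p. axis h p"
proof -
  obtain v0 where "v0 \<in> V" using V_nonempty by blast
  then obtain z where z: "z \<in> V" "\<And>x. x \<in> V \<Longrightarrow> d z (fst h z) \<le> d x (fst h x)"
    using ex_has_least_nat[of "\<lambda>x. x \<in> V" v0 "\<lambda>x. d x (fst h x)"] by blast
  define n where "n = d z (fst h z)"
  have hzV: "fst h z \<in> V" using h z by simp
  have n0: "n \<noteq> 0" using dist_0[OF z(1) hzV] nofix[OF z(1)] n_def by auto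
  \<comment> \<open>Parity rules out displacement one, which the inversion of an edge would
    have.\<close>
  have "even n" using ev z(1) by (simp add: even_displacement_def n_def)
  with n0 have n2: "2 \<le> n" by presburger
  obtain q where q: "q 0 = z" "q n = fst h z" "\<And>i. i < n \<Longrightarrow> (q i, q (Suc i)) \<in> E"
    using dist_relpow[OF z(1) hzV] unfolding n_def[symmetric] relpow_fun_conv by blast
  have walk: "i + l \<le> n \<Longrightarrow> (q i, q (i + l)) \<in> E ^^ l" for i l
  proof (induction l)
    case (Suc l)
    then show ?case using q(3)[of "i + l"] by auto
  qed simp
  then have qd: "i + l \<le> n \<Longrightarrow> d (q i) (q (i + l)) \<le> l" for i l using dist_le by blast
  have qV: "q i \<in> V" if "i \<le> n" for i
    using that q(3)[of i] E_V hzV q(2) by (cases "i = n") auto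
  have q2: "q i \<noteq> q (i + 2)" if i: "i + 2 \<le> n" for i
  proof
    assume e: "q i = q (i + 2)"
    have "n \<le> d z (q i) + d (q i) (fst h z)"
      unfolding n_def using dist_triangle[OF z(1) qV hzV] i by simp
    moreover have "d z (q i) \<le> i" using qd[of 0 i] i q(1) by simp
    moreover obtain l where l: "n = i + 2 + l" using i le_Suc_ex by blast
    then have "d (q i) (fst h z) \<le> l" using qd[of "i + 2" l] q(2) e by simp
    ultimately show False using l by linarith
  qed
  \<comment> \<open>No backtracking where two translates meet: otherwise \<open>q 1\<close> would
    have displacement at most \<open>n - 2\<close>.\<close>
  have q1: "q (n - 1) \<noteq> fst h (q 1)"
  proof
    assume "q (n - 1) = fst h (q 1)"
    then have "n \<le> d (q 1) (q (n - 1))" using z(2)[OF qV[of 1]] n2 n_def by simp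
    moreover obtain l where l: "n = 2 + l" using n2 le_Suc_ex by blast
    then have "d (q 1) (q (n - 1)) \<le> l" using qd[of 1 l] by simp
    ultimately show False using l by linarith
  qed
  define hp where "hp m = h [^]\<^bsub>Aut T\<^esub> m" for m :: int
  have hpC: "hp m \<in> C" for m using h by (simp add: hp_def)
  have hp_h: "fst (hp m) (fst h x) = fst (hp (m + 1)) x" if "x \<in> V" for m x
  proof -
    have "hp (m + 1) = hp m \<bullet> h" unfolding hp_def using A.int_pow_mult[OF h, of m 1] h by simp
    then show ?thesis using act_mult[OF hpC h that] by simp
  qed
  have h_hp: "fst h (fst (hp m) x) = fst (hp (m + 1)) x" if "x \<in> V" for m x
  proof -
    have "hp (m + 1) = h \<bullet> hp m" unfolding hp_def using A.int_pow_mult[OF h, of 1 m] h by (simp add: add.commute)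
    then show ?thesis using act_mult[OF h hpC that] by simp
  qed
  define k where "k = int n"
  define p where "p i = fst (hp (i div k)) (q (nat (i mod k)))" for i
  have k0: "k > 0" using n2 by (simp add: k_def)
  \<comment> \<open>The formula also holds for \<open>r = n\<close>, where it describes the start of
    the next translate, because \<open>q n\<close> is the image of \<open>z\<close>.\<close>
  have p: "p (m * k + int r) = fst (hp m) (q r)" if r: "r \<le> n" for m r
  proof (cases "r = n")
    case True
    have "p (m * k + int r) = fst (hp (m + 1)) z"
      using True k0 q(1) unfolding p_def k_def by (simp add: algebra_simps)
    then show ?thesis using hp_h[OF z(1)] True q(2) by simp
  next
    case False
    then have "int r < k" using r k_def by simp
    then show ?thesis unfolding p_def by simp
  qed
  have dec: "\<exists>m r. i = m * k + int r \<and> r < n" for i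
  proof -
    have "i = (i div k) * k + int (nat (i mod k))" "nat (i mod k) < n"
      using k0 by (auto simp: k_def nat_less_iff)
    then show ?thesis by blast
  qed
  have "line p"
    unfolding line_def
  proof
    fix i
    obtain m r where r: "i = m * k + int r" "r < n" using dec by blast
    have i1: "i + 1 = m * k + int (Suc r)" using r by simp
    have p0: "p i = fst (hp m) (q r)" using p[of r m] r by simp
    have p1: "p (i + 1) = fst (hp m) (q (Suc r))" unfolding i1 by (rule p) (use r(2) in simp)
    have "(p i, p (i + 1)) \<in> E" unfolding p0 p1 by (rule act_E[OF hpC q(3)[OF r(2)]])
    moreover have "p i \<noteq> p (i + 2)"
    proof (cases "r + 2 \<le> n")
      case True
      have "i + 2 = m * k + int (r + 2)" using r by simp
      then have "p (i + 2) = fst (hp m) (q (r + 2))" using p[OF True, of m] by metis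
      then show ?thesis using p0 q2[OF True] act_inj[OF hpC qV qV] True r(2) by simp
    next
      case False
      then have rn: "r = n - 1" using r(2) by simp
      then have i2: "i + 2 = (m + 1) * k + int 1" using r n2 unfolding k_def by (simp add: algebra_simps)
      have "p (i + 2) = fst (hp (m + 1)) (q 1)" unfolding i2 by (rule p) (use n2 in simp)
      also have "\<dots> = fst (hp m) (fst h (q 1))" using hp_h[OF qV[of 1]] n2 by simp
      finally have p2: "p (i + 2) = fst (hp m) (fst h (q 1))" .
      have "q r \<in> V" "fst h (q 1) \<in> V" using qV[of r] qV[of 1] r(2) n2 h by simp_all
      from act_inj[OF hpC this] show ?thesis using q1 rn unfolding p0 p2 by blast
    qed
    ultimately show "(p i, p (i + 1)) \<in> E \<and> p i \<noteq> p (i + 2)" ..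
  qed
  moreover have "fst h (p i) = p (i + k)" for i
  proof -
    obtain m r where r: "i = m * k + int r" "r < n" using dec by blast
    have ik: "i + k = (m + 1) * k + int r" using r by (simp add: algebra_simps)
    have "p (i + k) = fst (hp (m + 1)) (q r)" unfolding ik by (rule p) (use r(2) in simp)
    moreover have "p i = fst (hp m) (q r)" using p[of r m] r by simp
    ultimately show ?thesis using h_hp[OF qV[of r]] r(2) by simp
  qed
  ultimately show ?thesis using k0 unfolding axis_def by blast
qed

section \<open>Axes inside half-trees\<close>

lemma axis_line: "axis h p \<Longrightarrow> line p"
  by (simp add: axis_def)

lemma line_image: assumes "g \<in> C" "line p" shows "line (\<lambda>i. fst g (p i))"
  using assms act_E[OF assms(1)] act_inj[OF assms(1) line_V line_V] by (auto simp: line_def)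

lemma axis_conj:
  assumes g: "g \<in> C" and h: "h \<in> C" and p: "axis h p"
  shows "axis (g \<bullet> h \<bullet> iv g) (\<lambda>i. fst g (p i))"
proof -
  obtain k where k: "k > 0" "\<And>i. fst h (p i) = p (i + k)" using p by (auto simp: axis_def)
  have pV: "p i \<in> V" for i using line_V axis_line p by blast
  have "fst (g \<bullet> h \<bullet> iv g) (fst g (p i)) = fst g (p (i + k))" for i
    using g h pV k(2) by simp
  then show ?thesis using line_image[OF g axis_line[OF p]] k(1) unfolding axis_def by blast
qed

lemma line_side: assumes "line p" "i \<le> j" shows "p i \<in> side (p (j + 1)) (p j)" "p (j + 1) \<in> side (p i) (p (i + 1))"
proof -
  have "d (p i) (p (j + 1)) = nat (j + 1 - i)" "d (p i) (p j) = nat (j - i)"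
      "d (p (i + 1)) (p (j + 1)) = nat (j - i)"
    using line_dist[OF assms(1), of i "nat (j + 1 - i)"] line_dist[OF assms(1), of i "nat (j - i)"]
      line_dist[OF assms(1), of "i + 1" "nat (j - i)"] assms(2) by (simp_all add: algebra_simps)
  then show "p i \<in> side (p (j + 1)) (p j)" "p (j + 1) \<in> side (p i) (p (i + 1))"
    using line_V[OF assms(1)] assms(2) by (auto simp: side_def dist_sym nat_diff_distrib')
qed

text \<open>The second line has vertices on both sides of the edge from \<open>p j\<close> to
  \<open>p (j + 1)\<close> and is connected, so it contains this edge.\<close>

lemma line_convex:
  assumes p: "line p" and p': "line p'" and "p i \<in> range p'" "p l \<in> range p'" "i \<le> j" "j < l"
  shows "p j \<in> range p'"
proof -
  obtain a b where ab: "p i = p' a" "p l = p' b" using assms(3,4) by blast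
  have "p i \<in> side (p (j + 1)) (p j)" "p l \<in> side (p j) (p (j + 1))"
    using line_side[OF p, of i j] line_side[OF p, of j "l - 1"] assms(5,6) by auto
  then have "(p j, p (j + 1)) \<in> E \<inter> range p' \<times> range p'"
    using connected_crossing[OF line_connected[OF p', of a b] _ line_E[OF p]] ab by auto
  then show ?thesis by blast
qed

text \<open>First every half-tree meets an axis; then the arcs whose half-tree contains no axis form
  a flow. If both directions of an edge were such arcs, all axes would pass through it, hence
  coincide, and \<open>T\<close> would be a line.\<close>

lemma half_tree_axis:
  assumes G: "subgroup G (Aut T)" and nf: "no_flow G" and H: "subgroup H (Aut T)"
    and conj: "\<And>g h. g \<in> G \<Longrightarrow> h \<in> H \<Longrightarrow> g \<bullet> h \<bullet> iv g \<in> H"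
    and ev: "\<And>h. h \<in> H \<Longrightarrow> even_displacement h" and H1: "H \<noteq> {e1}"
    and notline: "\<And>p. line p \<Longrightarrow> range p \<noteq> V" and uv: "(u, v) \<in> E"
  shows "\<exists>h\<in>H. \<exists>p. axis h p \<and> range p \<subseteq> side u v"
proof -
  have GC: "g \<in> C" if "g \<in> G" for g using subgroup.subset[OF G] that by blast
  have HC: "h \<in> C" if "h \<in> H" for h using subgroup.subset[OF H] that by blast
  define X where "X = {range p | p h. h \<in> H \<and> axis h p}"
  have XV: "R \<subseteq> V" if "R \<in> X" for R using that line_V axis_line unfolding X_def by blast
  have "\<exists>h\<in>H. \<forall>c\<in>V. fst h c \<noteq> c"
    using elliptic_trivial[OF _ nf H conj] H1 GC by blast
  then obtain h0 where h0: "h0 \<in> H" "\<And>c. c \<in> V \<Longrightarrow> fst h0 c \<noteq> c" by blast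
  obtain p0 where "axis h0 p0" using ex_axis[OF HC[OF h0(1)] ev[OF h0(1)] h0(2)] by blast
  then have "range p0 \<in> X" using h0(1) unfolding X_def by blast
  then have X0: "X \<noteq> {}" by blast
  have X_conj: "fst g ` R \<in> X" if gC: "g \<in> C" and cj: "\<And>h. h \<in> H \<Longrightarrow> g \<bullet> h \<bullet> iv g \<in> H" and R: "R \<in> X" for g R
  proof -
    obtain p h where p: "R = range p" "h \<in> H" "axis h p" using R unfolding X_def by blast
    have "fst g ` R = range (\<lambda>i. fst g (p i))" using p(1) by (simp add: image_image)
    then show ?thesis using axis_conj[OF gC HC[OF p(2)] p(3)] cj[OF p(2)] unfolding X_def by blast
  qed
  have X_G: "fst g ` R \<in> X" if "g \<in> G" "R \<in> X" for g R
    using X_conj[OF GC[OF that(1)] conj[OF that(1)] that(2)] by blast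
  have X_H: "fst g ` R \<in> X" if "g \<in> H" "R \<in> X" for g R
    using X_conj[OF HC[OF that(1)] _ that(2)] subgroup.m_closed[OF H] subgroup.m_inv_closed[OF H] that(1) by blast
  have side_iv: "fst (iv g) w \<in> side a b"
    if g: "g \<in> G" and ab: "(a, b) \<in> E" and w: "w \<in> side (fst g a) (fst g b)" for g a b w
  proof -
    have "w \<in> V" using w side_V by blast
    then show ?thesis using act_side_inv[OF GC[OF g]] E_V[OF ab] w by blast
  qed
  have F1: "{(a, b) \<in> E. \<forall>R\<in>X. R \<inter> side a b = {}} = {}" (is "?F = {}")
  proof (rule no_flowD[OF nf])
    fix a b c assume "(a, b) \<in> ?F" "(b, c) \<in> E" "c \<noteq> a"
    then show "(b, c) \<in> ?F" using side_step[of a b c] by blast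
  next
    fix a b assume ab: "(a, b) \<in> ?F" "(b, a) \<in> ?F"
    obtain R where R: "R \<in> X" using X0 by blast
    then have "R \<noteq> {}" unfolding X_def by blast
    then obtain w where "w \<in> R" by blast
    then have "w \<in> side a b \<or> w \<in> side b a" using ab XV[OF R] side_compl[of a b w] by blast
    then show False using ab R \<open>w \<in> R\<close> by blast
  next
    fix g a b assume g: "g \<in> G" and ab: "(a, b) \<in> ?F"
    then have e: "(a, b) \<in> E" by blast
    have "w \<notin> side (fst g a) (fst g b)" if R: "R \<in> X" and w: "w \<in> R" for R w
    proof
      assume "w \<in> side (fst g a) (fst g b)"
      then have "fst (iv g) w \<in> side a b" by (rule side_iv[OF g e])
      moreover have "fst (iv g) ` R \<inter> side a b = {}"
        using X_G[OF subgroup.m_inv_closed[OF G g] R] ab by blast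
      ultimately show False using w by blast
    qed
    then show "(fst g a, fst g b) \<in> ?F" using act_E[OF GC[OF g] e] by blast
  qed auto
  have "{(a, b) \<in> E. \<forall>R\<in>X. \<not> R \<subseteq> side a b} = {}" (is "?F' = {}")
  proof (rule no_flowD[OF nf])
    fix a b c assume "(a, b) \<in> ?F'" "(b, c) \<in> E" "c \<noteq> a"
    then show "(b, c) \<in> ?F'" using side_step[of a b c] by blast
  next
    fix g a b assume g: "g \<in> G" and ab: "(a, b) \<in> ?F'"
    then have e: "(a, b) \<in> E" by blast
    have "\<not> R \<subseteq> side (fst g a) (fst g b)" if R: "R \<in> X" for R
    proof
      assume "R \<subseteq> side (fst g a) (fst g b)"
      then have "fst (iv g) ` R \<subseteq> side a b" using side_iv[OF g e] by blast
      then show False using X_G[OF subgroup.m_inv_closed[OF G g] R] ab by blast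
    qed
    then show "(fst g a, fst g b) \<in> ?F'" using act_E[OF GC[OF g] e] by blast
  next
    fix a b assume ab: "(a, b) \<in> ?F'" "(b, a) \<in> ?F'"
    then have e: "(a, b) \<in> E" by blast
    \<comment> \<open>The common part of all axes. It contains \<open>a\<close> and is invariant
      under \<open>H\<close>, since conjugation in \<open>H\<close> permutes the axes.\<close>
    define I where "I = \<Inter> X"
    have aI: "a \<in> I" unfolding I_def
    proof
      fix R assume R: "R \<in> X"
      then obtain p h where p: "R = range p" "axis h p" unfolding X_def by blast
      have "\<not> R \<subseteq> side a b" "\<not> R \<subseteq> side b a" using ab R by blast+
      then show "a \<in> R" using line_crossing[OF axis_line[OF p(2)] e] p(1) by simp
    qed
    have IH: "fst h x \<in> I" if h: "h \<in> H" and x: "x \<in> I" for h x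
      unfolding I_def
    proof
      fix R assume R: "R \<in> X"
      have "fst (iv h) ` R \<in> X" using X_H[OF subgroup.m_inv_closed[OF H h] R] .
      then obtain y where y: "y \<in> R" "x = fst (iv h) y" using x unfolding I_def by blast
      then have "fst h x = y" using HC[OF h] XV[OF R] by auto
      then show "fst h x \<in> R" using y by simp
    qed
    \<comment> \<open>The translates of \<open>a\<close> by powers of \<open>h\<close> run along
      \<open>R0\<close> to infinity in both directions and stay in \<open>I\<close>, hence in
      \<open>R\<close>; convexity fills the gaps.\<close>
    have sub: "R0 \<subseteq> R" if R0: "R0 \<in> X" and R: "R \<in> X" for R0 R
    proof -
      obtain p h where p: "R0 = range p" "h \<in> H" "axis h p" using R0 unfolding X_def by blast
      obtain p' h' where p': "R = range p'" "axis h' p'" using R unfolding X_def by blast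
      obtain k where k: "k > 0" "\<And>i. fst h (p i) = p (i + k)" using p(3) by (auto simp: axis_def)
      have ik: "fst (iv h) (p i) = p (i - k)" for i
        using k(2)[of "i - k"] act_inv(1)[OF HC[OF p(2)], of "p (i - k)"] line_V[OF axis_line[OF p(3)]] by simp
      obtain i where i: "a = p i" using aI R0 p(1) unfolding I_def by blast
      have up: "p (i + int n * k) \<in> I" for n
      proof (induction n)
        case (Suc n)
        have "p (i + int (Suc n) * k) = fst h (p (i + int n * k))" using k(2) by (simp add: algebra_simps)
        then show ?case using IH[OF p(2) Suc] by simp
      qed (use aI i in simp)
      have dn: "p (i - int n * k) \<in> I" for n
      proof (induction n)
        case (Suc n)
        have "p (i - int (Suc n) * k) = fst (iv h) (p (i - int n * k))" using ik by (simp add: algebra_simps)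
        then show ?case using IH[OF subgroup.m_inv_closed[OF H p(2)] Suc] by simp
      qed (use aI i in simp)
      show "R0 \<subseteq> R"
      proof
        fix x assume "x \<in> R0"
        then obtain j where j: "x = p j" using p(1) by blast
        \<comment> \<open>Large enough since \<open>k\<close> is at least 1; the added 1 gives the
          strict upper bound that \<open>line_convex\<close> asks for.\<close>
        define n where "n = nat (\<bar>j - i\<bar> + 1)"
        have "int n \<le> int n * k" using k(1) by (simp add: mult_le_cancel_left1)
        moreover have "int n = \<bar>j - i\<bar> + 1" unfolding n_def by simp
        ultimately have "i - int n * k \<le> j" "j < i + int n * k" by linarith+
        then have "p j \<in> range p'"
          using line_convex[OF axis_line[OF p(3)] axis_line[OF p'(2)]] up[of n] dn[of n] R p'(1)
          unfolding I_def by blast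
        then show "x \<in> R" using j p'(1) by simp
      qed
    qed
    obtain R where R: "R \<in> X" using X0 by blast
    then obtain p h where p: "R = range p" "axis h p" unfolding X_def by blast
    have eqR: "R' = R" if "R' \<in> X" for R' using sub R that by blast
    have "range p = V"
    proof (rule ccontr)
      assume "range p \<noteq> V"
      then obtain x where x: "x \<in> V" "x \<notin> range p" using line_V[OF axis_line[OF p(2)]] by blast
      have "(p 0, x) \<in> E\<^sup>*" using E_connected line_V[OF axis_line[OF p(2)]] x by blast
      from rtrancl_crossing[OF this _ x(2)]
      obtain c y where cy: "(c, y) \<in> E" "c \<in> range p" "y \<notin> range p" by blast
      \<comment> \<open>Beyond an edge leaving the only axis there is no vertex of an axis, contrary
        to \<open>F1\<close>.\<close>
      have "range p \<inter> side c y = {}"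
      proof (rule ccontr)
        assume "range p \<inter> side c y \<noteq> {}"
        then obtain l where l: "p l \<in> side c y" by blast
        obtain l0 where l0: "c = p l0" using cy by blast
        have "c \<in> side y c" using side_head[OF E_sym[OF cy(1)]] .
        then have "(c, y) \<in> E \<inter> range p \<times> range p"
          using connected_crossing[OF line_connected[OF axis_line[OF p(2)], of l0 l] _ cy(1)] l l0 by blast
        then show False using cy(3) by blast
      qed
      then show False using F1 cy(1) eqR p(1) by blast
    qed
    then show False using notline axis_line p(2) by blast
  qed auto
  then obtain R where "R \<in> X" "R \<subseteq> side u v" using uv by blast
  then show ?thesis unfolding X_def by blast
qed

text \<open>Induction on the distance from \<open>u\<close>: the arc leading to \<open>z\<close> on
  the geodesic from \<open>u\<close> is in the flow, and \<open>(z, z')\<close> continues it without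
  backtracking.\<close>

lemma flow_outward:
  assumes F: "flow H F" and uv: "(u, v) \<in> F"
  shows "z \<in> side u v \<Longrightarrow> (z, z') \<in> E \<Longrightarrow> d u z' = d u z + 1 \<Longrightarrow> (z, z') \<in> F"
proof (induction "d u z" arbitrary: z z' rule: less_induct)
  case less
  have FE: "F \<subseteq> E" and F1: "\<And>u v w. (u, v) \<in> F \<Longrightarrow> (v, w) \<in> E \<Longrightarrow> w \<noteq> u \<Longrightarrow> (v, w) \<in> F"
    using F unfolding flow_def by blast+
  have e: "(u, v) \<in> E" using FE uv by blast
  have V: "u \<in> V" "v \<in> V" "z \<in> V" using E_V[OF e] less.prems(1) side_V by auto
  show ?case
  proof (cases "z = v")
    case True
    have "z' \<noteq> u" using less.prems(3) by auto
    then show ?thesis using F1[OF uv] less.prems(2) True by blast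
  next
    case False
    then obtain y where y: "(y, z) \<in> E" "d v z = d v y + 1" using dist_closer V by metis
    have yV: "y \<in> V" using E_V y by blast
    have "d u z = d v z + 1" using less.prems(1) by (simp add: side_def dist_sym)
    moreover have "d u y \<le> d v y + 1" using dist_adj_le[OF yV E_sym[OF e]] by (simp add: dist_sym)
    moreover have "d u z \<le> d u y + 1" using dist_adj_le[OF V(1) y(1)] .
    ultimately have d: "d u z = d u y + 1" "d u y = d v y + 1" using y(2) by linarith+
    then have "y \<in> side u v" using yV by (simp add: side_def dist_sym)
    then have "(y, z) \<in> F" using less.hyps[of y z] d y by simp
    moreover have "z' \<noteq> y" using less.prems(3) d(1) by auto
    ultimately show ?thesis using F1 less.prems(2) by blast
  qed
qed

text \<open>Beyond a flow arc \<open>(u, v)\<close> choose an axis. From its vertex nearest to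
  \<open>u\<close> the flow runs along the axis in both directions, and translating by
  \<open>h\<close> makes the two directions collide.\<close>

lemma axes_no_flow:
  assumes H: "\<And>u v. (u, v) \<in> E \<Longrightarrow> \<exists>h\<in>H. \<exists>p. axis h p \<and> range p \<subseteq> side u v"
  shows "no_flow H"
  unfolding no_flow_def
proof (intro allI impI)
  fix F assume F: "flow H F"
  have FE: "F \<subseteq> E" and F1: "\<And>u v w. (u, v) \<in> F \<Longrightarrow> (v, w) \<in> E \<Longrightarrow> w \<noteq> u \<Longrightarrow> (v, w) \<in> F"
    and F2: "\<And>u v. (u, v) \<in> F \<Longrightarrow> (v, u) \<notin> F"
    and F3: "\<And>g u v. g \<in> H \<Longrightarrow> (u, v) \<in> F \<Longrightarrow> (fst g u, fst g v) \<in> F"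
    using F unfolding flow_def by blast+
  show "F = {}"
  proof (rule ccontr)
    assume "F \<noteq> {}"
    then obtain u v where uv: "(u, v) \<in> F" by auto
    then obtain h p where h: "h \<in> H" "axis h p" "range p \<subseteq> side u v" using H FE by blast
    note p = axis_line[OF h(2)]
    obtain k where k: "k > 0" "\<And>i. fst h (p i) = p (i + k)" using h(2) by (auto simp: axis_def)
    have uV: "u \<in> V" using E_V FE uv by blast
    obtain i where i: "\<And>j. d u (p i) \<le> d u (p j)"
      using ex_has_least_nat[of "\<lambda>_. True" 0 "\<lambda>j. d u (p j)"] by blast
    have "d u (p (i + 1)) = d u (p i) + 1" "d u (p (i - 1)) = d u (p i) + 1"
      using dist_adj[OF uV line_E[OF p, of i]] dist_adj[OF uV line_E'[OF p, of i]] i[of "i + 1"] i[of "i - 1"]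
      by linarith+
    then have f: "(p i, p (i + 1)) \<in> F" "(p i, p (i - 1)) \<in> F"
      using flow_outward[OF F uv] line_E[OF p] line_E'[OF p] h(3) by blast+
    have up: "(p (i + int n), p (i + int n + 1)) \<in> F" for n
    proof (induction n)
      case (Suc n)
      have "p (i + int n + 1 + 1) \<noteq> p (i + int n)" using injD[OF line_inj[OF p]] by fastforce
      then have "(p (i + int n + 1), p (i + int n + 1 + 1)) \<in> F" using F1[OF Suc] line_E[OF p] by blast
      then show ?case by (simp add: algebra_simps)
    qed (use f in simp)
    \<comment> \<open>The translate of the backward arc at \<open>p i\<close>; the forward flow
      contains its reverse.\<close>
    have "(p (i + k), p (i + k - 1)) \<in> F" using F3[OF h(1) f(2)] k(2)[of i] k(2)[of "i - 1"] by (simp add: algebra_simps)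
    moreover have "(p (i + k - 1), p (i + k)) \<in> F" using up[of "nat (k - 1)"] k(1) by (simp add: algebra_simps)
    ultimately show False using F2 by blast
  qed
qed

section \<open>Closest points on a line\<close>

lemma closest_point_in: "w \<in> L \<Longrightarrow> closest_point T L v \<in> L"
  unfolding closest_point_def by (rule arg_min_natI)

text \<open>\<open>closest_point\<close> is defined by choice, so a strict minimum is needed to
  identify its value.\<close>

lemma closest_point_eqI:
  assumes "m \<in> L" "\<And>x. x \<in> L \<Longrightarrow> x \<noteq> m \<Longrightarrow> d v m < d v x"
  shows "closest_point T L v = m"
proof (rule ccontr)
  assume "closest_point T L v \<noteq> m"
  then have "d v m < d v (closest_point T L v)" using assms closest_point_in by blast
  moreover have "d v (closest_point T L v) \<le> d v m"
    unfolding closest_point_def using arg_min_nat_le[of "\<lambda>w. w \<in> L" m "d v"] assms(1) by simp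
  ultimately show False by simp
qed

text \<open>Once the distance from \<open>v\<close> increases along the line,
  \<open>side_step\<close> keeps it increasing.\<close>

lemma line_dist_away:
  assumes p: "line p" and v: "v \<in> V" and i: "\<And>j. d v (p i) \<le> d v (p j)"
  shows "n > 0 \<Longrightarrow> d v (p i) < d v (p (i + int n))"
proof -
  have "v \<in> side (p (i + int n + 1)) (p (i + int n)) \<and> d v (p i) < d v (p (i + int n + 1))" for n
  proof (induction n)
    case 0
    have "d v (p (i + 1)) = d v (p i) + 1"
      using dist_adj[OF v line_E[OF p, of i]] i[of "i + 1"] by linarith
    then show ?case using v by (simp add: side_def)
  next
    case (Suc n)
    let ?j = "i + int n"
    have "p ?j \<noteq> p (?j + 1 + 1)" using injD[OF line_inj[OF p], of ?j "?j + 1 + 1"] by auto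
    then have "side (p (?j + 1)) (p ?j) \<subseteq> side (p (?j + 1 + 1)) (p (?j + 1))"
      by (rule side_step[OF E_sym[OF line_E[OF p]] E_sym[OF line_E[OF p]]])
    then have s: "v \<in> side (p (?j + 1 + 1)) (p (?j + 1))" using Suc by blast
    then have "d v (p (?j + 1 + 1)) = d v (p (?j + 1)) + 1" by (simp add: side_def)
    then have "d v (p i) < d v (p (?j + 1 + 1))" using Suc by linarith
    moreover have "?j + 1 = i + int (Suc n)" by simp
    ultimately show ?case using s by metis
  qed
  moreover assume "n > 0"
  then have "i + int n = i + int (n - 1) + 1" by simp
  ultimately show "d v (p i) < d v (p (i + int n))" by metis
qed

lemma line_closest_point:
  assumes p: "line p" and v: "v \<in> V" and i: "\<And>j. d v (p i) \<le> d v (p j)"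
  shows "closest_point T (range p) v = p i"
proof (rule closest_point_eqI)
  fix x assume "x \<in> range p" "x \<noteq> p i"
  then obtain j where j: "x = p j" "j \<noteq> i" by blast
  show "d v (p i) < d v x"
  proof (cases "i < j")
    case True
    then show ?thesis using line_dist_away[OF assms, of "nat (j - i)"] j by simp
  next
    case False
    have "d v (p i) < d v (p (- (- i + int (nat (i - j)))))"
      using line_dist_away[OF line_reverse[OF p] v, of "- i" "nat (i - j)"] i False j by simp
    then show ?thesis using False j by simp
  qed
qed simp

lemma line_closest_index:
  assumes p: "line p" and v: "v \<in> V"
  obtains i where "\<And>j. d v (p i) \<le> d v (p j)" "closest_point T (range p) v = p i"
proof -
  obtain i where "\<And>j. d v (p i) \<le> d v (p j)"
    using ex_has_least_nat[of "\<lambda>_. True" 0 "\<lambda>j. d v (p j)"] by blast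
  then show ?thesis using that line_closest_point[OF assms] by blast
qed

text \<open>A vertex of a line has at most two neighbours, so fixing it and one of them fixes the
  other as well.\<close>

lemma line_arc_fix_trivial:
  assumes p: "line p" "range p = V" and g: "g \<in> C" and uv: "(u, v) \<in> E" "fst g u = u" "fst g v = v"
  shows "g = e1"
proof (rule act_eqI[OF g A.one_closed])
  have two: "\<exists>a b. \<forall>x. (w, x) \<in> E \<longrightarrow> x = a \<or> x = b" if w: "w \<in> V" for w
  proof -
    obtain i where i: "w = p i" using w p(2) by blast
    have "x = p (i + 1) \<or> x = p (i - 1)" if wx: "(w, x) \<in> E" for x
    proof -
      obtain j where j: "x = p j" using E_V[OF wx] p(2) by blast
      have "d w x \<le> 1" using dist_le[of w x 1] wx by simp
      then have "\<bar>i - j\<bar> \<le> 1"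
        using line_dist[OF p(1), of i "nat (j - i)"] line_dist[OF p(1), of j "nat (i - j)"] i j
        by (cases "i \<le> j") (auto simp: dist_sym)
      moreover have "i \<noteq> j" using wx i j E_irrefl by auto
      ultimately have "j = i + 1 \<or> j = i - 1" by linarith
      then show ?thesis using j by blast
    qed
    then show ?thesis by blast
  qed
  fix x assume x: "x \<in> V"
  have "(u, x) \<in> E\<^sup>*" using E_connected E_V[OF uv(1)] x by blast
  \<comment> \<open>A fixed neighbour is carried along in the induction, since it forces the
    remaining neighbour to be fixed.\<close>
  then have "fst g x = x \<and> (\<exists>y. (x, y) \<in> E \<and> fst g y = y)"
  proof (induction rule: rtrancl_induct)
    case base
    then show ?case using uv by blast
  next
    case (step w x)
    then obtain y where y: "fst g w = w" "(w, y) \<in> E" "fst g y = y" by blast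
    have wV: "w \<in> V" "x \<in> V" "y \<in> V" using E_V[OF step(2)] E_V[OF y(2)] by auto
    have gx: "(w, fst g x) \<in> E" using act_E[OF g step(2)] y(1) by simp
    obtain a b where ab: "\<And>z. (w, z) \<in> E \<Longrightarrow> z = a \<or> z = b" using two wV(1) by blast
    have "fst g x = x"
    proof (cases "x = y")
      case False
      then have "fst g x \<noteq> y" using act_inj[OF g wV(2,3)] y(3) by simp
      then show ?thesis using ab[OF gx] ab[OF step(2)] ab[OF y(2)] False by metis
    qed (use y in simp)
    then show ?case using E_sym[OF step(2)] y(1) by blast
  qed
  then show "fst g x = fst e1 x" using x by simp
qed

section \<open>Parity of displacements, and powers of translations\<close>

lemma even_displacement_one: "even_displacement e1"
  by (simp add: even_displacement_def)

lemma even_displacement_mult: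
  assumes "g \<in> C" "h \<in> C" "even_displacement g" "even_displacement h"
  shows "even_displacement (g \<bullet> h)"
  unfolding even_displacement_def
proof
  fix v assume v: "v \<in> V"
  have "even (d v (fst h v) + d (fst h v) (fst g (fst h v)) + d v (fst g (fst h v)))"
    using dist_parity[OF v act_V[OF assms(2) v] act_V[OF assms(1) act_V[OF assms(2) v]]] .
  then show "even (d v (fst (g \<bullet> h) v))"
    using assms v unfolding even_displacement_def by simp
qed

lemma even_displacement_inv:
  assumes "g \<in> C" "even_displacement g"
  shows "even_displacement (iv g)"
  unfolding even_displacement_def
proof
  fix v assume v: "v \<in> V"
  have "even (d (fst (iv g) v) (fst g (fst (iv g) v)))"
    using bspec[OF assms(2)[unfolded even_displacement_def] act_V[OF A.inv_closed[OF assms(1)] v]] .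
  then show "even (d v (fst (iv g) v))" using assms(1) v by (simp add: dist_sym)
qed

text \<open>In the triangle formed by \<open>v\<close>, \<open>c\<close> and the image of
  \<open>v\<close>, the two sides at \<open>c\<close> are equal; \<open>dist_parity\<close> makes
  the third even.\<close>

lemma even_displacement_fix:
  assumes g: "g \<in> C" and c: "c \<in> V" "fst g c = c"
  shows "even_displacement g"
  unfolding even_displacement_def
proof
  fix v assume v: "v \<in> V"
  have "even (d v c + d c (fst g v) + d v (fst g v))"
    using dist_parity[OF v c(1) act_V[OF g v]] .
  moreover have "d c (fst g v) = d v c" using act_dist[OF g c(1) v] c(2) by (simp add: dist_sym)
  ultimately show "even (d v (fst g v))" by simp
qed

lemma translation_pow:
  assumes a: "a \<in> C" and p: "line p" and t: "\<And>i. fst a (p i) = p (i + k)"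
  shows "fst (a [^]\<^bsub>Aut T\<^esub> (n :: int)) (p i) = p (i + n * k)"
proof (induction n arbitrary: i rule: int_induct[where k = 0])
  case base
  then show ?case using line_V[OF p] by simp
next
  case (step1 n)
  have "a [^]\<^bsub>Aut T\<^esub> (n + 1) = (a [^]\<^bsub>Aut T\<^esub> n) \<bullet> a" using A.int_pow_mult[OF a, of n 1] a by simp
  then show ?case using a t step1(2)[of "i + k"] line_V[OF p] by (simp add: algebra_simps)
next
  case (step2 n)
  have "a [^]\<^bsub>Aut T\<^esub> (n - 1) = (a [^]\<^bsub>Aut T\<^esub> n) \<bullet> iv a"
    using A.int_pow_diff[OF a, of n 1] a by simp
  moreover have "fst (iv a) (p i) = p (i - k)"
    using t[of "i - k"] act_inv(1)[OF a line_V[OF p], of "i - k"] by simp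
  ultimately show ?case using a step2(2)[of "i - k"] line_V[OF p] by (simp add: algebra_simps)
qed

end

subsection \<open>Property P and simplicity\<close>

context tree_action
begin

section \<open>The subgroup generated by the arc stabilisers\<close>

abbreviation "K \<equiv> G_plus T G"

lemma stabilizer_arc: "a \<in> arcs T \<Longrightarrow> stabilizer (grp T G) snd a =
    {g \<in> G. fst g (origin T a) = origin T a \<and> fst g (terminus T a) = terminus T a}"
proof -
  have "carrier (grp T G) = G" by simp
  then show "a \<in> arcs T \<Longrightarrow> ?thesis" using act_arc_fix[OF G_C] unfolding stabilizer_def by blast
qed

lemma K_generators: "(\<Union>a\<in>arcs T. stabilizer (grp T G) snd a) =
    {g \<in> G. \<exists>u v. (u, v) \<in> E \<and> fst g u = u \<and> fst g v = v}" (is "?L = ?R")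
proof
  show "?L \<subseteq> ?R" using stabilizer_arc arc_E by blast
  show "?R \<subseteq> ?L"
  proof
    fix g assume "g \<in> ?R"
    then obtain a where a: "g \<in> G" "a \<in> arcs T" "fst g (origin T a) = origin T a" "fst g (terminus T a) = terminus T a"
      unfolding adj_def by blast
    then have "g \<in> stabilizer (grp T G) snd a" unfolding stabilizer_arc[OF a(2)] by blast
    then show "g \<in> ?L" using a(2) by blast
  qed
qed

lemma K_generate: "K = generate (Aut T) {g \<in> G. \<exists>u v. (u, v) \<in> E \<and> fst g u = u \<and> fst g v = v}"
  unfolding G_plus_def K_generators ..

lemma K_subgroup: "subgroup K (Aut T)"
  unfolding K_generate by (rule A.generate_is_subgroup) (use G_C in blast)

lemma K_memI: "g \<in> G \<Longrightarrow> (u, v) \<in> E \<Longrightarrow> fst g u = u \<Longrightarrow> fst g v = v \<Longrightarrow> g \<in> K"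
  unfolding K_generate by (rule generate.incl) blast

text \<open>Serves as the induction principle for \<open>K\<close>: parity, normality and the
  inclusions into \<open>G\<close> and into a normal subgroup are all proved through it.\<close>

lemma K_least: assumes "subgroup N (Aut T)"
    "\<And>g u v. g \<in> G \<Longrightarrow> (u, v) \<in> E \<Longrightarrow> fst g u = u \<Longrightarrow> fst g v = v \<Longrightarrow> g \<in> N"
  shows "K \<subseteq> N"
  unfolding K_generate by (rule A.generate_subgroup_incl[OF _ assms(1)]) (use assms(2) in blast)

lemma K_even: assumes "g \<in> K" shows "even_displacement g"
proof -
  have "subgroup {g \<in> C. even_displacement g} (Aut T)"
  proof (rule A.subgroupI)
    show "{g \<in> C. even_displacement g} \<noteq> {}" using even_displacement_one A.one_closed by blast
  qed (use even_displacement_mult even_displacement_inv A.inv_closed A.m_closed in blast)+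
  then have "K \<subseteq> {g \<in> C. even_displacement g}"
    by (rule K_least) (use even_displacement_fix G_C E_V in blast)
  then show ?thesis using assms by blast
qed

text \<open>The preimage of \<open>N\<close> under conjugation by \<open>g\<close>, in the form in
  which \<open>K_least\<close> can be applied to it.\<close>

lemma conj_subgroup:
  assumes "subgroup N (Aut T)" "g \<in> C"
  shows "subgroup {h \<in> C. g \<bullet> h \<bullet> iv g \<in> N} (Aut T)"
proof (rule A.subgroupI)
  have "e1 \<in> {h \<in> C. g \<bullet> h \<bullet> iv g \<in> N}" using assms subgroup.one_closed by simp
  then show "{h \<in> C. g \<bullet> h \<bullet> iv g \<in> N} \<noteq> {}" by blast
  fix a assume a: "a \<in> {h \<in> C. g \<bullet> h \<bullet> iv g \<in> N}"
  then have "iv (g \<bullet> a \<bullet> iv g) = g \<bullet> iv a \<bullet> iv g"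
    using assms(2) by (simp add: A.inv_mult_group A.m_assoc)
  then show "iv a \<in> {h \<in> C. g \<bullet> h \<bullet> iv g \<in> N}"
    using a subgroup.m_inv_closed[OF assms(1), of "g \<bullet> a \<bullet> iv g"] by simp
  fix b assume b: "b \<in> {h \<in> C. g \<bullet> h \<bullet> iv g \<in> N}"
  have "iv g \<bullet> (g \<bullet> (b \<bullet> iv g)) = b \<bullet> iv g"
    using A.m_assoc[of "iv g" g "b \<bullet> iv g"] b assms(2) by simp
  then have "(g \<bullet> a \<bullet> iv g) \<bullet> (g \<bullet> b \<bullet> iv g) = g \<bullet> (a \<bullet> b) \<bullet> iv g"
    using a b assms(2) by (simp add: A.m_assoc)
  then show "a \<bullet> b \<in> {h \<in> C. g \<bullet> h \<bullet> iv g \<in> N}"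
    using a b subgroup.m_closed[OF assms(1), of "g \<bullet> a \<bullet> iv g" "g \<bullet> b \<bullet> iv g"] by simp
qed auto

lemma K_normal: assumes g: "g \<in> G" and h: "h \<in> K" shows "g \<bullet> h \<bullet> iv g \<in> K"
proof -
  have "K \<subseteq> {h \<in> C. g \<bullet> h \<bullet> iv g \<in> K}"
  proof (rule K_least[OF conj_subgroup[OF K_subgroup G_C[OF g]]])
    fix h u v assume h: "h \<in> G" and uv: "(u, v) \<in> E" "fst h u = u" "fst h v = v"
    have "g \<bullet> h \<bullet> iv g \<in> K"
      using G_mult G_inv g h act_E[OF G_C[OF g] uv(1)] G_C[OF g] G_C[OF h] E_V[OF uv(1)] uv(2,3)
      by (intro K_memI[of _ "fst g u" "fst g v"]) auto
    then show "h \<in> {h \<in> C. g \<bullet> h \<bullet> iv g \<in> K}" using G_C[OF h] by blast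
  qed
  then show ?thesis using h by blast
qed

text \<open>Surjectivity in property (P) read as gluing: an element of the stabiliser may be
  prescribed independently on each fibre of the closest point projection.\<close>

lemma property_P_glue:
  assumes P: "property_P T G" and path: "simple_path T I p" and f: "\<And>x. x \<in> p ` I \<Longrightarrow> f x \<in> pointwise_stab G (p ` I)"
  shows "\<exists>g\<in>pointwise_stab G (p ` I). \<forall>v\<in>V. fst g v = fst (f (closest_point T (p ` I) v)) v"
proof -
  let ?L = "p ` I"
  have L0: "?L \<noteq> {}" using path by (auto simp: simple_path_def)
  have "(\<lambda>g. \<lambda>x\<in>?L. fibre_action T ?L x g) ` pointwise_stab G ?L
      = (\<Pi>\<^sub>E x\<in>?L. fibre_action T ?L x ` pointwise_stab G ?L)"
    using P[unfolded property_P_def Let_def, rule_format, OF path] .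
  moreover have "(\<lambda>x\<in>?L. fibre_action T ?L x (f x)) \<in> (\<Pi>\<^sub>E x\<in>?L. fibre_action T ?L x ` pointwise_stab G ?L)"
    unfolding restrict_PiE_iff using f by blast
  ultimately obtain g where g: "g \<in> pointwise_stab G ?L"
    "(\<lambda>x\<in>?L. fibre_action T ?L x (f x)) = (\<lambda>x\<in>?L. fibre_action T ?L x g)" by blast
  have "fst g v = fst (f (closest_point T ?L v)) v" if v: "v \<in> V" for v
  proof -
    let ?x = "closest_point T ?L v"
    have x: "?x \<in> ?L" using closest_point_in L0 by blast
    then have "fibre_action T ?L ?x (f ?x) = fibre_action T ?L ?x g"
      using fun_cong[OF g(2), of ?x] by simp
    then have "fibre_action T ?L ?x (f ?x) v = fibre_action T ?L ?x g v" by (rule fun_cong)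
    then show ?thesis using v by (simp add: fibre_action_def)
  qed
  then show ?thesis using g(1) by blast
qed

lemma line_simple_path: "line p \<Longrightarrow> simple_path T UNIV p"
  using line_V line_inj line_E by (auto simp: simple_path_def)

text \<open>
  An element fixing the axis of \<open>h\<close> pointwise is a commutator \<open>x h x\<^sup>-\<^sup>1 h\<^sup>-\<^sup>1\<close>. The equation
  \<open>x h = g h x\<close> determines \<open>x\<close> on the fibre over \<open>p (i + k)\<close> from its values on the fibre over \<open>p i\<close>,
  and \<open>x = 1\<close> on the fibres over \<open>p 0, \<dots>, p (k - 1)\<close> leads to \<open>x = (g h)\<^sup>n h\<^sup>-\<^sup>n\<close> with \<open>n = i div k\<close>.
\<close>

lemma axis_stab_commutator:
  assumes P: "property_P T G" and h: "h \<in> G" and p: "axis h p" and g: "g \<in> pointwise_stab G (range p)"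
  shows "\<exists>x\<in>pointwise_stab G (range p). x \<bullet> h = g \<bullet> h \<bullet> x"
proof -
  note l = axis_line[OF p]
  have pV: "p i \<in> V" for i using line_V[OF l] .
  obtain k where k: "k > 0" "\<And>i. fst h (p i) = p (i + k)" using p by (auto simp: axis_def)
  have gG: "g \<in> G" and gp: "\<And>i. fst g (p i) = p i" using g by (auto simp: pointwise_stab_def)
  note hC = G_C[OF h] and gC = G_C[OF gG]
  let ?a = "g \<bullet> h"
  have aG: "?a \<in> G" using G_mult gG h .
  then have aC: "?a \<in> C" using G_C by blast
  have ap: "fst ?a (p i) = p (i + k)" for i using gC hC pV k(2) gp by simp
  define y where "y n = (?a [^]\<^bsub>Aut T\<^esub> n) \<bullet> (h [^]\<^bsub>Aut T\<^esub> (- n))" for n :: int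
  have yG: "y n \<in> G" for n
    unfolding y_def using A.subgroup_int_pow_closed[OF G] G_mult aG h by blast
  note yC = G_C[OF yG]
  have yp: "fst (y n) (p i) = p i" for n i
    unfolding y_def using translation_pow[OF hC l k(2)] translation_pow[OF aC l ap] aC hC pV by simp
  have ys: "y (n + 1) \<bullet> h = ?a \<bullet> y n" for n
  proof -
    have "h [^]\<^bsub>Aut T\<^esub> (- (n + 1)) \<bullet> h = h [^]\<^bsub>Aut T\<^esub> (- n)"
      using A.int_pow_mult[OF hC, of "- (n + 1)" 1] hC by simp
    moreover have "?a [^]\<^bsub>Aut T\<^esub> (n + 1) = ?a \<bullet> (?a [^]\<^bsub>Aut T\<^esub> n)"
      using A.int_pow_mult[OF aC, of 1 n] aC by (simp add: add.commute)
    ultimately show ?thesis unfolding y_def using aC hC A.m_assoc A.int_pow_closed A.m_closed by metis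
  qed
  \<comment> \<open>\<open>inv_into\<close> recovers the index \<open>i\<close> from
    \<open>p i\<close>, so the fibres over one period of length \<open>k\<close> share the element
    \<open>y (i div k)\<close>.\<close>
  define f where "f x = y (inv_into UNIV p x div k)" for x
  have fp: "f (p i) = y (i div k)" for i unfolding f_def by (simp add: inv_f_f[OF line_inj[OF l]])
  have "f x \<in> pointwise_stab G (p ` UNIV)" for x
    unfolding f_def pointwise_stab_def using yG yp by auto
  from property_P_glue[OF P line_simple_path[OF l], of f, OF this]
  obtain x where x: "x \<in> pointwise_stab G (range p)"
    "\<And>v. v \<in> V \<Longrightarrow> fst x v = fst (f (closest_point T (range p) v)) v" by blast
  have xC: "x \<in> C" using x(1) G_C by (auto simp: pointwise_stab_def)
  have "x \<bullet> h = ?a \<bullet> x"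
  proof (rule act_eqI)
    fix v assume v: "v \<in> V"
    obtain i where i: "\<And>j. d v (p i) \<le> d v (p j)" "closest_point T (range p) v = p i"
      using line_closest_index[OF l v] by blast
    have hv: "fst h v \<in> V" using hC v by simp
    \<comment> \<open>\<open>h\<close> preserves distances and shifts the axis by \<open>k\<close>,
      so it carries the fibre over \<open>p i\<close> to the one over
      \<open>p (i + k)\<close>.\<close>
    have "closest_point T (range p) (fst h v) = p (i + k)"
    proof (rule line_closest_point[OF l hv])
      fix j
      have "d (fst h v) (p (i + k)) = d v (p i)" using act_dist[OF hC v pV, of i] k(2) by simp
      also have "\<dots> \<le> d v (p (j - k))" by (rule i(1))
      also have "\<dots> = d (fst h v) (p j)" using act_dist[OF hC v pV, of "j - k"] k(2)[of "j - k"] by simp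
      finally show "d (fst h v) (p (i + k)) \<le> d (fst h v) (p j)" .
    qed
    then have "fst x (fst h v) = fst (y ((i + k) div k)) (fst h v)" using x(2)[OF hv] fp by simp
    also have "(i + k) div k = i div k + 1" using k(1) by simp
    also have "fst (y (i div k + 1)) (fst h v) = fst (y (i div k + 1) \<bullet> h) v" using act_mult[OF yC hC v] by simp
    also have "\<dots> = fst ?a (fst (y (i div k)) v)" unfolding ys using act_mult[OF aC yC v] .
    also have "fst (y (i div k)) v = fst x v" using x(2)[OF v] i(2) fp by simp
    finally show "fst (x \<bullet> h) v = fst (?a \<bullet> x) v" using xC hC aC v by simp
  qed (use xC hC aC in auto)
  then show ?thesis using x(1) by blast
qed

text \<open>The \<open>x\<close> of \<open>axis_stab_commutator\<close> fixes the arcs of the axis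
  and so lies in \<open>K\<close>, which normalises \<open>N\<close>; hence its commutator with
  \<open>h\<close> lies in \<open>N\<close>.\<close>

lemma axis_stab_subset:
  assumes P: "property_P T G" and N: "subgroup N (Aut T)" "N \<subseteq> K"
    and conj: "\<And>x h. x \<in> K \<Longrightarrow> h \<in> N \<Longrightarrow> x \<bullet> h \<bullet> iv x \<in> N"
    and KG: "K \<subseteq> G" and h: "h \<in> N" "axis h p"
  shows "pointwise_stab G (range p) \<subseteq> N"
proof
  fix g assume g: "g \<in> pointwise_stab G (range p)"
  have hG: "h \<in> G" using h N KG by blast
  obtain x where x: "x \<in> pointwise_stab G (range p)" "x \<bullet> h = g \<bullet> h \<bullet> x"
    using axis_stab_commutator[OF P hG h(2) g] by blast
  have xG: "x \<in> G" "g \<in> G" using x(1) g by (auto simp: pointwise_stab_def)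
  note C = G_C[OF xG(1)] G_C[OF xG(2)] G_C[OF hG]
  have "x \<in> K" using K_memI[OF xG(1) line_E[OF axis_line[OF h(2)], of 0]] x(1) by (auto simp: pointwise_stab_def)
  then have "x \<bullet> h \<bullet> iv x \<bullet> iv h \<in> N"
    using conj h(1) subgroup.m_closed[OF N(1)] subgroup.m_inv_closed[OF N(1)] by blast
  moreover have "x \<bullet> h \<bullet> iv x \<bullet> iv h = g \<bullet> h \<bullet> (x \<bullet> iv x) \<bullet> iv h"
    unfolding x(2) using C by (simp add: A.m_assoc)
  moreover have "\<dots> = g" using C by (simp add: A.m_assoc)
  ultimately show "g \<in> N" by simp
qed

text \<open>Property (P) for the path with the single edge \<open>(u, v)\<close>, whose fibres are
  the two half-trees: \<open>g1\<close> acts as \<open>g\<close> over \<open>u\<close> and trivially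
  over \<open>v\<close>, and \<open>g2\<close> is the remaining factor.\<close>

lemma arc_stab_split:
  assumes P: "property_P T G" and uv: "(u, v) \<in> E" and g: "g \<in> G" "fst g u = u" "fst g v = v"
  shows "\<exists>g1 g2. g1 \<in> pointwise_stab G (side u v) \<and> g2 \<in> pointwise_stab G (side v u) \<and> g = g1 \<bullet> g2"
proof -
  define p where "p i = (if i = 0 then u else v)" for i :: int
  have V: "u \<in> V" "v \<in> V" using E_V[OF uv] by auto
  have "u \<noteq> v" using uv E_irrefl by blast
  have L: "p ` {0, 1} = {u, v}" by (auto simp: p_def)
  have "inj_on p {0, 1}" using \<open>u \<noteq> v\<close> by (auto simp: p_def)
  moreover have "\<forall>i\<in>{0, 1}. \<forall>j\<in>{0, 1}. {i..j} \<subseteq> {0, 1 :: int}" by auto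
  ultimately have path: "simple_path T {0, 1} p" using uv V by (auto simp: simple_path_def p_def)
  define f where "f x = (if x = u then g else e1)" for x
  have "f x \<in> pointwise_stab G (p ` {0, 1})" for x
    unfolding L using g G_one V by (simp add: f_def pointwise_stab_def)
  from property_P_glue[OF P path, of f, OF this]
  obtain g1 where g1: "g1 \<in> pointwise_stab G {u, v}"
    "\<And>w. w \<in> V \<Longrightarrow> fst g1 w = fst (f (closest_point T {u, v} w)) w" unfolding L by blast
  have g1G: "g1 \<in> G" using g1 by (simp add: pointwise_stab_def)
  note C = G_C[OF g1G] G_C[OF g(1)]
  have "fst g1 w = w" if w: "w \<in> side u v" for w
  proof -
    have "closest_point T {u, v} w = v" using w by (intro closest_point_eqI) (auto simp: side_def)
    then show ?thesis using g1(2)[of w] w side_V \<open>u \<noteq> v\<close> by (auto simp: f_def)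
  qed
  then have 1: "g1 \<in> pointwise_stab G (side u v)" using g1G by (simp add: pointwise_stab_def)
  have 2: "fst g1 w = fst g w" if w: "w \<in> side v u" for w
  proof -
    have "closest_point T {u, v} w = u" using w by (intro closest_point_eqI) (auto simp: side_def)
    then show ?thesis using g1(2)[of w] w side_V by (auto simp: f_def)
  qed
  have "fst (iv g1 \<bullet> g) w = w" if w: "w \<in> side v u" for w
  proof -
    have wV: "w \<in> V" using w side_V by blast
    then show ?thesis using 2[OF w] act_inv(1)[OF C(1) wV] C by simp
  qed
  then have "iv g1 \<bullet> g \<in> pointwise_stab G (side v u)"
    using G_mult[OF G_inv[OF g1G] g(1)] by (simp add: pointwise_stab_def)
  moreover have "g = g1 \<bullet> (iv g1 \<bullet> g)" using C by (simp add: A.m_assoc[symmetric])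
  ultimately show ?thesis using 1 by blast
qed

section \<open>Simplicity\<close>

lemma K_G: "K \<subseteq> G"
  by (rule K_least[OF G])

text \<open>\<open>half_tree_axis\<close> is used twice, first for \<open>K\<close> normalised by
  \<open>G\<close>, then for a nontrivial normal subgroup \<open>N\<close> normalised by
  \<open>K\<close>. In between, \<open>axes_no_flow\<close> passes the absence of flows on to
  \<open>K\<close>.\<close>

lemma no_flow_simple:
  assumes P: "property_P T G" and nf: "no_flow G" and K1: "K \<noteq> {e1}"
  shows "abstractly_simple (grp T K)"
proof -
  \<comment> \<open>On a line all arc stabilisers are trivial, which would make \<open>K\<close>
    trivial.\<close>
  have notline: "range p \<noteq> V" if p: "line p" for p
  proof
    assume "range p = V"
    then have "K \<subseteq> {e1}"
      using line_arc_fix_trivial[OF p] G_C by (intro K_least A.triv_subgroup) blast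
    then show False using K1 subgroup.one_closed[OF K_subgroup] by blast
  qed
  have ax: "\<exists>h\<in>K. \<exists>p. axis h p \<and> range p \<subseteq> side u v" if "(u, v) \<in> E" for u v
    by (rule half_tree_axis[OF G nf K_subgroup K_normal K_even K1 notline that])
  have nfK: "no_flow K" by (rule axes_no_flow[OF ax])
  have "N = K" if N: "N \<lhd> grp T K" and N1: "N \<noteq> {e1}" for N
  proof -
    have NK: "subgroup N (grp T K)" using N by (simp add: normal_def)
    then have sub: "N \<subseteq> K" using subgroup.subset by force
    have NA: "subgroup N (Aut T)" by (rule A.incl_subgroup[OF K_subgroup NK])
    have conj: "x \<bullet> h \<bullet> iv x \<in> N" if "x \<in> K" "h \<in> N" for x h
      using normal.inv_op_closed2[OF N, of x h] that A.m_inv_consistent[OF K_subgroup that(1)] by simp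
    have axN: "\<exists>h\<in>N. \<exists>p. axis h p \<and> range p \<subseteq> side u v" if "(u, v) \<in> E" for u v
      by (rule half_tree_axis[OF K_subgroup nfK NA conj _ N1 notline that]) (use K_even sub in auto)
    \<comment> \<open>Fixing a half-tree entails fixing the axis of an element of \<open>N\<close>
      inside it.\<close>
    have stab: "pointwise_stab G (side u v) \<subseteq> N" if uv: "(u, v) \<in> E" for u v
    proof -
      obtain h p where h: "h \<in> N" "axis h p" "range p \<subseteq> side u v" using axN[OF uv] by blast
      have "pointwise_stab G (side u v) \<subseteq> pointwise_stab G (range p)"
        using h(3) by (auto simp: pointwise_stab_def)
      then show ?thesis using axis_stab_subset[OF P NA sub conj K_G h(1,2)] by blast
    qed
    have "K \<subseteq> N"
    proof (rule K_least[OF NA])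
      fix g u v assume g: "g \<in> G" and uv: "(u, v) \<in> E" "fst g u = u" "fst g v = v"
      obtain g1 g2 where "g1 \<in> pointwise_stab G (side u v)" "g2 \<in> pointwise_stab G (side v u)" "g = g1 \<bullet> g2"
        using arc_stab_split[OF P uv(1) g uv(2,3)] by blast
      then show "g \<in> N" using stab[OF uv(1)] stab[OF E_sym[OF uv(1)]] subgroup.m_closed[OF NA] by blast
    qed
    then show ?thesis using sub by blast
  qed
  then show ?thesis
    unfolding abstractly_simple_def using A.subgroup_imp_group[OF K_subgroup] K1 by auto
qed

text \<open>The colours are the arcs at the chosen representative of the orbit, which need not be
  \<open>v\<close> but has the same degree. Nonemptiness is recorded because \<open>card\<close>
  does not distinguish the empty set from an infinite one.\<close>

lemma vert_colours_eq:
  assumes lad: "is_local_action_diagram T G \<Delta>" and v: "v \<in> V"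
  shows "card (vert_colours \<Delta> (vo v)) = card (arcs_from T v)"
    and "leaf Q (vo v) \<Longrightarrow> vert_colours \<Delta> (vo v) \<noteq> {}"
proof -
  have base: "base \<Delta> = Q" using lad by (simp add: is_local_action_diagram_def)
  obtain s where s: "s \<in> V" "vo s = vo v"
    "\<And>a. a \<in> arcs_from Q (vo v) \<Longrightarrow> arc_colours \<Delta> a = {b \<in> arcs_from T s. ao b = a}"
  proof -
    have vQ: "vo v \<in> verts (base \<Delta>)" using v base by simp
    obtain t where t: "\<forall>v\<in>verts (base \<Delta>). t v \<in> V \<and> vo (t v) = v \<and>
        (\<forall>a\<in>arcs_from (base \<Delta>) v. arc_colours \<Delta> a = {b \<in> arcs_from T (t v). ao b = a}) \<and>
        local_group \<Delta> v = Sym_topology (vert_colours \<Delta> v) closure_of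
            ((\<lambda>g. restrict (snd g) (vert_colours \<Delta> v)) ` stabilizer (grp T G) fst (t v))"
      using conjunct2[OF lad[unfolded is_local_action_diagram_def]] by (elim exE)
    show ?thesis by (rule that[of "t (vo v)"]) (use bspec[OF t vQ] base in auto)
  qed
  have af: "arcs_from Q (vo v) = ao ` arcs_from T s" using Q_arcs_from[OF s(1)] s(2) by simp
  have vc: "vert_colours \<Delta> (vo v) = arcs_from T s"
    unfolding vert_colours_def base using s(3) unfolding af by blast
  then show "card (vert_colours \<Delta> (vo v)) = card (arcs_from T v)"
    using card_arcs_from_orbit[OF s(1) v s(2)] by simp
  show "leaf Q (vo v) \<Longrightarrow> vert_colours \<Delta> (vo v) \<noteq> {}"
    unfolding vc leaf_def af by auto
qed

end

theorem corollary1p6: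
  fixes T :: "('v, 'a) arc_graph"
    and G :: "(('v \<Rightarrow> 'v) \<times> ('a \<Rightarrow> 'a)) set"
    and \<Delta> :: "('v set, 'a set, 'a) action_diagram"
  assumes "tree T"
    and "subgroup G (Aut T)"
    and "property_P T G"
    and "is_local_action_diagram T G \<Delta>"
    and "finite_graph (base \<Delta>)"
    and "\<not> cycle_graph (base \<Delta>)"
  shows "(geometrically_dense T G \<longleftrightarrow>
            (\<forall>v. leaf (base \<Delta>) v \<longrightarrow>
               infinite (vert_colours \<Delta> v) \<or> 1 < card (vert_colours \<Delta> v))) \<and>
         ((\<nexists>v. stray_leaf \<Delta> v) \<longrightarrow>
            abstractly_simple (grp T (G_plus T G)) \<or>
            carrier (grp T (G_plus T G)) = {\<one>\<^bsub>grp T (G_plus T G)\<^esub>})"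
proof -
  interpret tree_action T G
    by (intro tree_action.intro tree_action_axioms.intro tree_graph.intro assms)
  have base: "base \<Delta> = Q" using assms(4) by (simp add: is_local_action_diagram_def)
  have leaf_V: "leaf Q x \<Longrightarrow> \<exists>v\<in>V. x = vo v" for x by (auto simp: leaf_def)
  note colours = vert_colours_eq[OF assms(4)]
  have us: "no_stray \<longleftrightarrow> (\<nexists>v. stray_leaf \<Delta> v)"
    unfolding no_stray_def stray_leaf_def base using leaf_V colours(1) by metis
  \<comment> \<open>The colour set at a leaf is nonempty, so cardinality 0 can only mean that it is
    infinite.\<close>
  have "infinite (vert_colours \<Delta> x) \<or> 1 < card (vert_colours \<Delta> x) \<longleftrightarrow> card (vert_colours \<Delta> x) \<noteq> 1"
    if "leaf Q x" for x
  proof -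
    have "vert_colours \<Delta> x \<noteq> {}" using leaf_V[OF that] colours(2) that by blast
    then have "infinite (vert_colours \<Delta> x) \<or> card (vert_colours \<Delta> x) \<noteq> 0" by auto
    moreover have "infinite (vert_colours \<Delta> x) \<Longrightarrow> card (vert_colours \<Delta> x) \<noteq> 1" by simp
    ultimately show ?thesis by linarith
  qed
  then have us': "(\<forall>v. leaf Q v \<longrightarrow> infinite (vert_colours \<Delta> v) \<or> 1 < card (vert_colours \<Delta> v)) \<longleftrightarrow> no_stray"
    unfolding us stray_leaf_def base by blast
  have nf: "no_stray \<Longrightarrow> no_flow G" using no_flowI assms(5,6) base by simp
  have "geometrically_dense T G \<longleftrightarrow> no_stray"
    using nf no_flow_dense[OF G] dense_imp_no_stray by blast
  moreover have "no_stray \<Longrightarrow> abstractly_simple (grp T K) \<or> K = {e1}"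
    using nf no_flow_simple[OF assms(3)] by blast
  ultimately show ?thesis using us us' base by simp
qed

end
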